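(* Let $f:S^{1}\rightarrow S^{1}$ be an orientation preserving homeomorphism of the circle with irrational rotation number. Suppose that $f$ is $C^{1}$ and that the logarithm of its derivative, $\log f'$, is a (continuous, real-valued) function which has bounded Zygmund variation and bounded quadratic variation. Then $f$ is topologically conjugate to a rigid rotation, i.e. there are a homeomorphism $h:S^1\to S^1$ and an irrational rotation $R$ of $S^1$ with $h\circ f=R\circ h$.
   Context: $S^1=\mathbb{R}/\mathbb{Z}$. The rotation number of $f$ is $\rho(f)=\lim_{n\to\infty}\frac{F^{n}(x)-x}{n} \bmod 1$, where $F:\mathbb{R}\to\mathbb{R}$ is any lift of $f$ and $x\in\mathbb{R}$ is arbitrary. Let $I\subset\mathbb{R}$ be a compact interval and $\phi:I\to\mathbb{R}$ continuous. $\phi$ is of bounded Zygmund variation if there is $B>0$ with $$\sup_{\{x_0,\dots,x_n\}}\sum_{i=0}^{n-1}\left|\phi(x_i)+\phi(x_{i+1})-2\phi\left(\tfrac{x_i+x_{i+1}}{2}\right)\right|\le B,$$ where the supremum is over all partitions $x_0<x_1<\dots<x_n$ of $I$ (with $x_0,x_n$ the endpoints of $I$). $\phi$ is of bounded quadratic variation if there is $B>0$ with $$\sup_{\{x_0,\dots,x_n\}}\sum_{i=0}^{n-1}(\phi(x_{i+1})-\phi(x_i))^2\le B,$$ with the supremum over all partitions of $I$. For a function on the circle such as $\log f'$, these notions are applied to the corresponding function $\log F'$ on a fundamental domain $[0,1]$, where $F$ is a lift of $f$. *)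

theory Defs
  imports "HOL-Analysis.Analysis"
begin

quotient_type circle = real / "\<lambda>x y :: real. x - y \<in> \<int>"
  morphisms rep_circle to_circle
proof (rule equivpI)
  show "reflp (\<lambda>x y :: real. x - y \<in> \<int>)"
    by (simp add: reflp_def)
  show "symp (\<lambda>x y :: real. x - y \<in> \<int>)"
    by (metis (no_types, lifting) Ints_minus minus_diff_eq sympI)
  show "transp (\<lambda>x y :: real. x - y \<in> \<int>)"
    by (rule transpI) (metis (no_types, lifting) Ints_add add_diff_eq diff_add_cancel)
qed

lemma to_circle_eq_iff: "to_circle x = to_circle y \<longleftrightarrow> x - y \<in> \<int>"
  by (rule circle.abs_eq_iff)

lemma to_circle_surj: "\<exists>x. z = to_circle x"
  by (metis Quotient3_abs_rep Quotient3_circle)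

text \<open>The circle carries the quotient topology of the real line.\<close>

instantiation circle :: topological_space
begin

definition open_circle :: "circle set \<Rightarrow> bool" where
  "open_circle U \<longleftrightarrow> open (to_circle -` U)"

instance
  by standard (auto simp: open_circle_def vimage_Union intro: open_Int)

end

lift_definition rotation :: "real \<Rightarrow> circle \<Rightarrow> circle" is "\<lambda>\<alpha> x. x + \<alpha>"
  by simp

definition is_lift :: "(circle \<Rightarrow> circle) \<Rightarrow> (real \<Rightarrow> real) \<Rightarrow> bool" where
  "is_lift f F \<longleftrightarrow> continuous_on UNIV F \<and> (\<forall>x. to_circle (F x) = f (to_circle x))"

text \<open>Two lifts differ by an integer constant, so if one lift is increasing, all are.\<close>

definition orientation_preserving_homeo :: "(circle \<Rightarrow> circle) \<Rightarrow> bool" where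
  "orientation_preserving_homeo f \<longleftrightarrow>
     (\<exists>g. homeomorphism UNIV UNIV f g) \<and> (\<exists>F. is_lift f F \<and> strict_mono F)"

text \<open>The residue modulo 1 is represented by its value in \<open>[0, 1)\<close>.\<close>

definition rotation_number :: "(circle \<Rightarrow> circle) \<Rightarrow> real" where
  "rotation_number f =
     (THE r. \<forall>F x. is_lift f F \<longrightarrow>
        (\<exists>L. (\<lambda>n. ((F ^^ n) x - x) / real n) \<longlonglongrightarrow> L \<and> r = frac L))"

text \<open>The defining condition has exactly one solution: a lift exists, the limit exists for
  every lift and base point, and its residue modulo 1 does not depend on these choices.\<close>

lemma continuous_Ints_valued_constant:
  fixes g :: "real \<Rightarrow> real"
  assumes "continuous_on UNIV g" "\<And>x. g x \<in> \<int>"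
  shows "g x = g y"
proof -
  have "g constant_on UNIV"
  proof (rule continuous_discrete_range_constant[OF _ assms(1)])
    show "\<exists>e>0. \<forall>y. y \<in> UNIV \<and> g y \<noteq> g x \<longrightarrow> e \<le> norm (g y - g x)" for x
    proof (intro exI[of _ 1] conjI allI impI)
      fix y assume y: "y \<in> UNIV \<and> g y \<noteq> g x"
      have "g y - g x \<in> \<int>" using assms(2) by simp
      then show "1 \<le> norm (g y - g x)"
        using y Ints_nonzero_abs_ge1[of "g y - g x"] by simp
    qed simp
  qed simp
  then show ?thesis by (auto simp: constant_on_def)
qed

lemma lifts_differ_by_Ints:
  assumes "is_lift f F" "is_lift f G"
  obtains k where "k \<in> \<int>" "\<And>x. F x = G x + k"
proof
  have int: "F x - G x \<in> \<int>" for x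
    using assms by (simp add: is_lift_def flip: to_circle_eq_iff)
  show "F 0 - G 0 \<in> \<int>" by (rule int)
  have "continuous_on UNIV (\<lambda>x. F x - G x)"
    using assms by (auto simp: is_lift_def intro: continuous_on_diff)
  then have "F x - G x = F 0 - G 0" for x
    using int by (rule continuous_Ints_valued_constant)
  then show "F x = G x + (F 0 - G 0)" for x
    by (metis diff_add_cancel add.commute)
qed

lemma orientation_preserving_lift:
  assumes "orientation_preserving_homeo f" "is_lift f F"
  shows "strict_mono F" "F (x + 1) = F x + 1"
proof -
  obtain G where G: "is_lift f G" "strict_mono G"
    using assms(1) by (auto simp: orientation_preserving_homeo_def)
  obtain k where "\<And>x. F x = G x + k"
    using lifts_differ_by_Ints[OF assms(2) G(1)] by blast
  then show mono: "strict_mono F"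
    using G(2) by (simp add: strict_mono_def)
  have cont: "continuous_on UNIV F" and lift: "to_circle (F x) = f (to_circle x)" for x
    using assms(2) by (auto simp: is_lift_def)
  have inj: "inj f"
    using assms(1)
    by (auto simp: orientation_preserving_homeo_def homeomorphism_def inj_def) metis
  have "to_circle (x + 1) = to_circle x"
    by (simp add: to_circle_eq_iff)
  then have "F (x + 1) - F x \<in> \<int>"
    by (simp add: lift flip: to_circle_eq_iff)
  moreover have pos: "F (x + 1) - F x > 0"
    using mono by (simp add: strict_mono_def)
  ultimately have ge: "F (x + 1) - F x \<ge> 1"
    using Ints_nonzero_abs_ge1[of "F (x + 1) - F x"] by simp
  obtain y where y: "x \<le> y" "y \<le> x + 1" "F y = F x + 1"
    using IVT'[of F x "F x + 1" "x + 1"] ge continuous_on_subset[OF cont] by auto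
  have "to_circle (F y) = to_circle (F x)"
    using y(3) by (simp add: to_circle_eq_iff)
  then have "to_circle y = to_circle x"
    using inj lift by (metis injD)
  then have "y - x \<in> \<int>"
    by (simp add: to_circle_eq_iff)
  moreover have "y \<noteq> x"
    using y(3) by auto
  ultimately have "y - x \<ge> 1"
    using Ints_nonzero_abs_ge1[of "y - x"] y(1) by simp
  then have "y = x + 1"
    using y(2) by simp
  then show "F (x + 1) = F x + 1"
    using y(3) by simp
qed

lemma degree_one_add_of_int:
  fixes F :: "real \<Rightarrow> real"
  assumes "\<And>x. F (x + 1) = F x + 1"
  shows "F (x + of_int k) = F x + of_int k"
proof (induction k arbitrary: x rule: int_induct[where k = 0])
  case (step1 i)
  then show ?case using assms[of "x + of_int i"] by (simp add: algebra_simps)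
next
  case (step2 i)
  then show ?case using assms[of "x + of_int i - 1"] by (simp add: algebra_simps)
qed simp

lemma degree_one_displacement:
  fixes F :: "real \<Rightarrow> real"
  assumes "mono F" "\<And>x. F (x + 1) = F x + 1"
  shows "\<bar>(F x - x) - (F y - y)\<bar> \<le> 1"
proof -
  define k where "k = \<lfloor>x - y\<rfloor>"
  have k: "y + of_int k \<le> x" "x \<le> y + of_int k + 1"
    unfolding k_def by linarith+
  have "F (y + of_int k) \<le> F x" "F x \<le> F (y + of_int k + 1)"
    using k assms(1) by (auto dest: monoD)
  then show ?thesis
    using k degree_one_add_of_int[of F y k] assms(2)[of "y + of_int k"] assms(2) by auto
qed

lemma translation_limit_exists:
  fixes F :: "real \<Rightarrow> real"
  assumes mono: "mono F" and deg: "\<And>x. F (x + 1) = F x + 1"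
  obtains L where "\<And>x. (\<lambda>n. ((F ^^ n) x - x) / real n) \<longlonglongrightarrow> L"
proof -
  have monon: "mono (F ^^ n)" for n
    by (induction n) (use mono in \<open>auto simp: mono_def\<close>)
  have degn: "(F ^^ n) (x + 1) = (F ^^ n) x + 1" for n x
    by (induction n) (auto simp: deg)
  have disp: "\<bar>((F ^^ n) x - x) - ((F ^^ n) y - y)\<bar> \<le> 1" for n x y
    by (rule degree_one_displacement[OF monon degn])
  define a where "a n = (F ^^ n) 0" for n
  have mult: "\<bar>a (m * n) - real m * a n\<bar> \<le> real m" for m n
  proof (induction m)
    case (Suc m)
    have "a (Suc m * n) = (F ^^ n) (a (m * n))"
      by (simp add: a_def funpow_add)
    then have "\<bar>a (Suc m * n) - a (m * n) - a n\<bar> \<le> 1"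
      using disp[of n "a (m * n)" 0] by (simp add: a_def)
    with Suc show ?case by (simp add: algebra_simps)
  qed (simp add: a_def)
  have close: "\<bar>a n / real n - a m / real m\<bar> \<le> 1 / real n + 1 / real m" if "n > 0" "m > 0" for m n
  proof -
    have "\<bar>real m * a n - real n * a m\<bar> \<le> real m + real n"
      using mult[of m n] mult[of n m] by (simp add: mult.commute)
    then have "\<bar>real m * a n - real n * a m\<bar> / (real m * real n)
        \<le> (real m + real n) / (real m * real n)"
      by (rule divide_right_mono) simp
    moreover have "\<bar>real m * a n - real n * a m\<bar> / (real m * real n)
        = \<bar>(real m * a n - real n * a m) / (real m * real n)\<bar>"
      by (simp add: abs_mult)
    moreover have "(real m * a n - real n * a m) / (real m * real n) = a n / real n - a m / real m"
      using that by (simp add: field_simps)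
    moreover have "(real m + real n) / (real m * real n) = 1 / real n + 1 / real m"
      using that by (simp add: field_simps)
    ultimately show ?thesis by simp
  qed
  have "Cauchy (\<lambda>n. a n / real n)"
  proof (rule metric_CauchyI)
    fix e :: real assume "e > 0"
    then obtain N where N: "N > 0" "1 / real N < e / 2"
      by (metis half_gt_zero nat_approx_posE of_nat_Suc zero_less_Suc)
    have "dist (a m / real m) (a n / real n) < e" if "m \<ge> N" "n \<ge> N" for m n
    proof -
      have "1 / real m \<le> 1 / real N" "1 / real n \<le> 1 / real N"
        using that N(1) by (auto intro!: divide_left_mono)
      then show ?thesis
        using close[of m n] that N by (simp add: dist_real_def)
    qed
    then show "\<exists>M. \<forall>m\<ge>M. \<forall>n\<ge>M. dist (a m / real m) (a n / real n) < e"
      by blast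
  qed
  then obtain L where L: "(\<lambda>n. a n / real n) \<longlonglongrightarrow> L"
    by (auto simp: Cauchy_convergent_iff convergent_def)
  have "(\<lambda>n. ((F ^^ n) x - x) / real n) \<longlonglongrightarrow> L" for x
  proof -
    have "(\<lambda>n. ((F ^^ n) x - x) / real n - a n / real n) \<longlonglongrightarrow> 0"
    proof (rule Lim_null_comparison)
      show "eventually (\<lambda>n. norm (((F ^^ n) x - x) / real n - a n / real n) \<le> 1 / real n) sequentially"
      proof (rule always_eventually, rule allI)
        fix n
        have "\<bar>(F ^^ n) x - x - a n\<bar> \<le> 1"
          using disp[of n x 0] by (simp add: a_def)
        then show "norm (((F ^^ n) x - x) / real n - a n / real n) \<le> 1 / real n"
          by (simp add: divide_right_mono flip: diff_divide_distrib)
      qed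
      show "(\<lambda>n. 1 / real n) \<longlonglongrightarrow> 0"
        by (rule lim_1_over_n)
    qed
    from tendsto_add[OF this L] show ?thesis by simp
  qed
  then show ?thesis by (rule that)
qed

lemma rotation_number_eqI:
  assumes f: "orientation_preserving_homeo f" and F: "is_lift f F"
    and L: "(\<lambda>n. ((F ^^ n) x - x) / real n) \<longlonglongrightarrow> L"
  shows "rotation_number f = frac L"
  unfolding rotation_number_def
proof (rule the_equality)
  show "r = frac L" if "\<forall>F x. is_lift f F \<longrightarrow>
      (\<exists>L. (\<lambda>n. ((F ^^ n) x - x) / real n) \<longlonglongrightarrow> L \<and> r = frac L)" for r
    using that F L LIMSEQ_unique by metis
  have deg: "F (x + 1) = F x + 1" for x
    using orientation_preserving_lift[OF f F] by simp
  have "mono F"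
    using orientation_preserving_lift(1)[OF f F] by (simp add: strict_mono_mono)
  then obtain L' where L': "\<And>y. (\<lambda>n. ((F ^^ n) y - y) / real n) \<longlonglongrightarrow> L'"
    using translation_limit_exists deg by blast
  with L have L'_eq: "L' = L"
    using LIMSEQ_unique by blast
  show "\<forall>G y. is_lift f G \<longrightarrow>
      (\<exists>M. (\<lambda>n. ((G ^^ n) y - y) / real n) \<longlonglongrightarrow> M \<and> frac L = frac M)"
  proof (intro allI impI)
    fix G y assume "is_lift f G"
    then obtain k where k: "k \<in> \<int>" "\<And>x. G x = F x + k"
      using lifts_differ_by_Ints F by blast
    then obtain j where j: "k = of_int j"
      by (auto elim: Ints_cases)
    have iter: "(G ^^ n) y = (F ^^ n) y + real n * k" for n
    proof (induction n)
      case (Suc n)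
      have "F ((F ^^ n) y + of_int (int n * j)) = F ((F ^^ n) y) + of_int (int n * j)"
        by (rule degree_one_add_of_int) (rule deg)
      with Suc show ?case by (simp add: k(2) j algebra_simps)
    qed simp
    have "(\<lambda>n. ((F ^^ n) y - y) / real n + k) \<longlonglongrightarrow> L + k"
      using L' by (intro tendsto_intros) (simp add: L'_eq)
    moreover have "eventually (\<lambda>n. ((F ^^ n) y - y) / real n + k = ((G ^^ n) y - y) / real n) sequentially"
      using eventually_gt_at_top[of 0] by eventually_elim (simp add: iter field_simps)
    ultimately have "(\<lambda>n. ((G ^^ n) y - y) / real n) \<longlonglongrightarrow> L + k"
      by (rule Lim_transform_eventually)
    moreover have "frac L = frac (L + k)"
      using k(1) by (simp add: j frac_def)
    ultimately show "\<exists>M. (\<lambda>n. ((G ^^ n) y - y) / real n) \<longlonglongrightarrow> M \<and> frac L = frac M"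
      by blast
  qed
qed

lemma rotation_number_limit:
  assumes "orientation_preserving_homeo f" "is_lift f F"
  obtains L where "(\<lambda>n. ((F ^^ n) x - x) / real n) \<longlonglongrightarrow> L" "rotation_number f = frac L"
proof -
  have "mono F" "\<And>x. F (x + 1) = F x + 1"
    using orientation_preserving_lift[OF assms] by (simp_all add: strict_mono_mono)
  then obtain L where L: "\<And>x. (\<lambda>n. ((F ^^ n) x - x) / real n) \<longlonglongrightarrow> L"
    using translation_limit_exists by blast
  show ?thesis
    by (rule that[OF L rotation_number_eqI[OF assms L]])
qed

text \<open>The derivative of a circle map at the class of \<open>x\<close> is the derivative at \<open>x\<close> of any of its
  lifts; as lifts differ by constants, being continuously differentiable does not depend on the lift.\<close>

definition C1_circle_map :: "(circle \<Rightarrow> circle) \<Rightarrow> bool" where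
  "C1_circle_map f \<longleftrightarrow> (\<exists>F. is_lift f F \<and> F C1_differentiable_on UNIV)"

definition interval_partition :: "real \<Rightarrow> real \<Rightarrow> nat \<Rightarrow> (nat \<Rightarrow> real) \<Rightarrow> bool" where
  "interval_partition a b n x \<longleftrightarrow> x 0 = a \<and> x n = b \<and> (\<forall>i<n. x i < x (Suc i))"

text \<open>A bound on the supremum over all partitions is expressed as a uniform bound on the sums, because
  a real-valued supremum of an unbounded set is unspecified.\<close>

definition bounded_zygmund_variation :: "real \<Rightarrow> real \<Rightarrow> (real \<Rightarrow> real) \<Rightarrow> bool" where
  "bounded_zygmund_variation a b \<phi> \<longleftrightarrow>
     (\<exists>B>0. \<forall>n x. interval_partition a b n x \<longrightarrow>
        (\<Sum>i<n. \<bar>\<phi> (x i) + \<phi> (x (Suc i)) - 2 * \<phi> ((x i + x (Suc i)) / 2)\<bar>) \<le> B)"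

definition bounded_quadratic_variation :: "real \<Rightarrow> real \<Rightarrow> (real \<Rightarrow> real) \<Rightarrow> bool" where
  "bounded_quadratic_variation a b \<phi> \<longleftrightarrow>
     (\<exists>B>0. \<forall>n x. interval_partition a b n x \<longrightarrow>
        (\<Sum>i<n. (\<phi> (x (Suc i)) - \<phi> (x i))\<^sup>2) \<le> B)"

end

theory Submission
  imports Defs
begin

text \<open>Let \<open>F\<close> be a lift of \<open>f\<close>, let \<open>\<alpha>\<close> be its translation number and \<open>\<phi> = ln F'\<close>. Since \<open>\<alpha>\<close> is irrational,
  there is a nondecreasing continuous \<open>H\<close> of degree one with \<open>H \<circ> F = H + \<alpha>\<close>. It induces the desired
  conjugacy as soon as it is injective, so the whole point is that \<open>H\<close> has no plateau, i.e. that \<open>f\<close>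
  has no wandering interval.

  In the classical case, where \<open>\<phi>\<close> has bounded variation, one controls the ratio of derivatives of
  \<open>F ^^ n\<close> at two points. Here the first differences of \<open>\<phi>\<close> are only square summable and the second
  differences summable, so one looks for a quantity whose distortion involves no first difference
  to first order. The cross-ratio of four points \<open>a < b < c < d\<close> is such a quantity: the logarithm of
  the slope of \<open>F\<close> on an interval is the value at its midpoint of an affine function close to \<open>\<phi>\<close>,
  up to the deviation of \<open>\<phi>\<close> from that function and the square of its increment, and the four
  midpoint values cancel. The deviation from the affine interpolant is in turn bounded by one second
  difference. This is \<open>log_cross_ratio_distortion_bound\<close>, and adding it up over disjoint intervals uses
  exactly the two variations.

  Let \<open>g = F\<^sup>q + p\<close> be a closest return, acting as the small translation \<open>\<epsilon> = q \<alpha> + p > 0\<close> in the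
  coordinate \<open>H\<close>. The first images of the interval from \<open>w\<close> to \<open>g (g (g w))\<close> have bounded overlap in
  the circle, so cross-ratios of \<open>w, g w, g (g w), g (g (g w))\<close> change by a bounded factor along this
  orbit segment, uniformly in \<open>\<epsilon>\<close> (\<open>distortion_sum_orbit\<close>). Start at a point \<open>x0\<close> where \<open>g x - x\<close>
  is least: both neighbours of the interval from \<open>x0\<close> to \<open>g x0\<close> are at least as long as the interval
  itself, so the cross-ratio is at least 1/3 there. Pulling back, every interval
  from \<open>y\<close> to \<open>g y\<close> in the backward orbit is at most a constant times as long as its right neighbour
  (\<open>pullback_of_shortest_return\<close>).

  Suppose finally that \<open>H\<close> is constant on an interval of positive length. The backward orbit of \<open>x0\<close> is
  \<open>\<epsilon>\<close>-dense in the coordinate \<open>H\<close>, which yields two adjacent pulled back intervals that cover the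
  plateau, while the interval to the right of them lies in a gap that shrinks to the right end of the
  plateau as \<open>\<epsilon>\<close> tends to 0. Its length tends to 0, contradicting the uniform comparison of
  lengths (\<open>semiconj_inj\<close>).\<close>

section \<open>Closest returns of an irrational rotation\<close>

definition dist_int :: "real \<Rightarrow> real" where
  "dist_int x = \<bar>x - of_int (round x)\<bar>"

lemma dist_int_le: "dist_int x \<le> \<bar>x - of_int k\<bar>"
  unfolding dist_int_def using round_diff_minimal[of x k] by (simp add: abs_minus_commute)

lemma irrational_multiple_not_Ints:
  assumes "\<alpha> \<notin> \<rat>" "i \<noteq> 0"
  shows "of_int i * \<alpha> \<noteq> of_int k"
proof
  assume "of_int i * \<alpha> = of_int k"
  then have "\<alpha> = of_int k / of_int i"
    using assms(2) by (simp add: field_simps)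
  then show False
    using assms(1) by (metis Rats_divide Rats_of_int)
qed

lemma exists_small_multiple:
  fixes \<alpha> \<delta> :: real
  assumes "\<delta> > 0"
  obtains j :: nat where "j > 0" "dist_int (real j * \<alpha>) < \<delta>"
proof -
  obtain M :: nat where M: "M > 0" "1 / real M < \<delta>"
    using assms by (metis nat_approx_posE of_nat_Suc zero_less_Suc)
  obtain h k where hk: "0 < k" "\<bar>of_int k * \<alpha> - of_int h\<bar> < 1 / real M"
    using Dirichlet_approx[OF M(1), of \<alpha>] by metis
  have "dist_int (real (nat k) * \<alpha>) < \<delta>"
    using dist_int_le[of "real (nat k) * \<alpha>" h] hk M by simp
  with hk(1) show ?thesis by (intro that[of "nat k"]) auto
qed

text \<open>Take for \<open>q\<close> a closest return time (or its negative, so that \<open>\<epsilon>\<close> is positive) and for \<open>N\<close> the next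
  closest return time. Separation is the minimality of \<open>N\<close>. Density is the gap statement that
  consecutive points of the orbit of length \<open>\<bar>q\<bar> + N\<close> are at most \<open>\<epsilon>\<close> apart: a point of the orbit can be
  moved right by at most \<open>\<epsilon>\<close> within the orbit, by applying one of the two returns forwards or
  backwards, since these lie on opposite sides.\<close>

lemma rotation_combinatorics:
  fixes \<alpha> \<delta> :: real
  assumes irr: "\<alpha> \<notin> \<rat>" and "\<delta> > 0"
  obtains q p :: int and N :: nat and \<epsilon> :: real
  where "\<epsilon> = of_int q * \<alpha> + of_int p" "0 < \<epsilon>" "\<epsilon> < \<delta>" "\<bar>q\<bar> < int N"
    and "\<And>i k :: int. i \<noteq> 0 \<Longrightarrow> \<bar>i\<bar> < int N \<Longrightarrow> \<epsilon> \<le> \<bar>of_int i * \<alpha> + of_int k\<bar>"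
    and "\<And>z. \<exists>i < 2 * N. \<exists>k :: int. 0 \<le> z - (real i * \<alpha> + of_int k) \<and> z - (real i * \<alpha> + of_int k) < \<epsilon>"
proof -
  define d where "d j = dist_int (real j * \<alpha>)" for j :: nat
  have d_pos: "d j > 0" if "j > 0" for j
    using irrational_multiple_not_Ints[OF irr, of "int j" "round (real j * \<alpha>)"] that
    by (simp add: d_def dist_int_def)
  obtain j0 where j0: "j0 > 0" "d j0 < \<delta>"
    using exists_small_multiple[OF \<open>\<delta> > 0\<close>] unfolding d_def by blast
  define q0 where "q0 = arg_min_on d {1..j0}"
  have q0: "q0 \<in> {1..j0}" and q0_min: "\<And>j. j \<in> {1..j0} \<Longrightarrow> d q0 \<le> d j"
    using arg_min_if_finite[of "{1..j0}" d] arg_min_least[of "{1..j0}" _ d] j0(1)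
    unfolding q0_def by auto
  define \<epsilon> where "\<epsilon> = d q0"
  have \<epsilon>: "0 < \<epsilon>" "\<epsilon> < \<delta>"
    using d_pos[of q0] q0 q0_min[of j0] j0 by (auto simp: \<epsilon>_def)
  define N where "N = (LEAST j. j > 0 \<and> d j < \<epsilon>)"
  have N: "N > 0" "d N < \<epsilon>"
    using exists_small_multiple[OF \<epsilon>(1), of \<alpha>] LeastI_ex[of "\<lambda>j. j > 0 \<and> d j < \<epsilon>"]
    unfolding N_def d_def by blast+
  have sep: "\<epsilon> \<le> d j" if "0 < j" "j < N" for j
    using not_less_Least[of j "\<lambda>j. j > 0 \<and> d j < \<epsilon>"] that unfolding N_def by auto
  have "j0 < N"
    using q0_min[of N] N unfolding \<epsilon>_def by (cases "N \<le> j0") auto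
  then have qN: "0 < q0" "q0 < N" using q0 by auto
  have sep': "\<epsilon> \<le> \<bar>of_int i * \<alpha> + of_int k\<bar>" if "i \<noteq> 0" "\<bar>i\<bar> < int N" for i k :: int
  proof -
    have "\<epsilon> \<le> d (nat \<bar>i\<bar>)" using that by (intro sep) auto
    also have "\<dots> \<le> \<bar>real (nat \<bar>i\<bar>) * \<alpha> - of_int (- sgn i * k)\<bar>"
      unfolding d_def by (rule dist_int_le)
    also have "\<dots> = \<bar>of_int i * \<alpha> + of_int k\<bar>"
    proof (cases "i > 0")
      case False
      then have "real (nat \<bar>i\<bar>) * \<alpha> - of_int (- sgn i * k) = - (of_int i * \<alpha> + of_int k)"
        using that(1) by simp
      then show ?thesis by (simp only: abs_minus_cancel)
    qed simp
    finally show ?thesis .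
  qed
  \<comment> \<open>The two returns lie on opposite sides of the base point: otherwise their difference,
     reached at time \<open>N - q0 < N\<close>, would be a closer return.\<close>
  define u where "u = real q0 * \<alpha> - of_int (round (real q0 * \<alpha>))"
  define v where "v = real N * \<alpha> - of_int (round (real N * \<alpha>))"
  have absu: "\<bar>u\<bar> = \<epsilon>" and absv: "0 < \<bar>v\<bar>" "\<bar>v\<bar> < \<epsilon>"
    using N d_pos[of N] by (auto simp: u_def v_def \<epsilon>_def d_def dist_int_def)
  have "\<epsilon> \<le> \<bar>v - u\<bar>"
    using sep'[of "int N - int q0" "round (real q0 * \<alpha>) - round (real N * \<alpha>)"] qN
    by (simp add: u_def v_def algebra_simps)
  then have opp: "u > 0 \<and> v < 0 \<or> u < 0 \<and> v > 0"
    using absu absv by linarith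
  have dense: "\<exists>i < 2 * N. \<exists>k :: int. 0 \<le> z - (real i * \<alpha> + of_int k) \<and> z - (real i * \<alpha> + of_int k) < \<epsilon>"
    for z
  proof -
    define t where "t i = frac (z - real i * \<alpha>)" for i :: nat
    define i where "i = arg_min_on t {..<q0 + N}"
    have i: "i < q0 + N" and i_min: "\<And>j. j < q0 + N \<Longrightarrow> t i \<le> t j"
      using arg_min_if_finite[of "{..<q0 + N}" t] arg_min_least[of "{..<q0 + N}" _ t] qN
      unfolding i_def by auto
    have step: False if "j < q0 + N" "real j * \<alpha> = real i * \<alpha> + e + of_int k" "0 < e" "e \<le> t i"
      for j e and k :: int
    proof -
      have "t j = t i - e"
        unfolding t_def
      proof (subst frac_unique_iff, intro conjI)
        have "z - real j * \<alpha> - (frac (z - real i * \<alpha>) - e) = of_int (\<lfloor>z - real i * \<alpha>\<rfloor> - k)"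
          using that(2) by (simp add: frac_def)
        then show "z - real j * \<alpha> - (frac (z - real i * \<alpha>) - e) \<in> \<int>" by simp
        show "frac (z - real i * \<alpha>) - e \<ge> 0" using that(4) by (simp add: t_def)
        show "frac (z - real i * \<alpha>) - e < 1"
          using that(3) frac_lt_1[of "z - real i * \<alpha>"] by linarith
      qed
      with i_min[OF that(1)] that(3) show False by simp
    qed
    have "t i < \<epsilon>"
    proof (rule ccontr)
      assume "\<not> t i < \<epsilon>"
      then have ti: "\<epsilon> \<le> t i" by simp
      consider "u > 0" "v < 0" "i < N" | "u > 0" "v < 0" "N \<le> i"
        | "u < 0" "v > 0" "q0 \<le> i" | "u < 0" "v > 0" "i < q0"
        using opp by linarith
      then show False
      proof cases
        case 1
        show ?thesis
          using step[of "i + q0" u "round (real q0 * \<alpha>)"] 1 i ti absu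
          by (simp add: u_def distrib_right)
      next
        case 2
        show ?thesis
          using step[of "i - N" "- v" "- round (real N * \<alpha>)"] 2 i ti absv
          by (simp add: v_def left_diff_distrib of_nat_diff less_imp_diff_less)
      next
        case 3
        show ?thesis
          using step[of "i - q0" "- u" "- round (real q0 * \<alpha>)"] 3 i ti absu
          by (simp add: u_def left_diff_distrib of_nat_diff less_imp_diff_less)
      next
        case 4
        show ?thesis
          using step[of "i + N" v "round (real N * \<alpha>)"] 4 i ti absv
          by (simp add: v_def distrib_right)
      qed
    qed
    moreover have "z - (real i * \<alpha> + of_int \<lfloor>z - real i * \<alpha>\<rfloor>) = t i"
      by (simp add: t_def frac_def)
    ultimately show ?thesis
      using i qN by (intro exI[of _ i] conjI exI[of _ "\<lfloor>z - real i * \<alpha>\<rfloor>"]) (auto simp: t_def)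
  qed
  show ?thesis
  proof (cases "u > 0")
    case True
    then show ?thesis
      using \<epsilon> qN absu
      by (intro that[of \<epsilon> "int q0" "- round (real q0 * \<alpha>)" N] sep' dense) (auto simp: u_def)
  next
    case False
    then show ?thesis
      using \<epsilon> qN absu opp
      by (intro that[of \<epsilon> "- int q0" "round (real q0 * \<alpha>)" N] sep' dense) (auto simp: u_def)
  qed
qed

section \<open>Variation sums over disjoint intervals\<close>

text \<open>The case \<open>c = d\<close> is included because the intervals collected below may touch each other and the end
  points.\<close>

lemma interval_partition_extend:
  assumes "interval_partition a c n x" "c \<le> d" and nonneg: "\<And>u v. (0::real) \<le> g u v"
  obtains n' x' where "interval_partition a d n' x'"
    and "(\<Sum>i<n. g (x i) (x (Suc i))) + (if c < d then g c d else 0) \<le> (\<Sum>i<n'. g (x' i) (x' (Suc i)))"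
proof (cases "c < d")
  case True
  define y where "y = x (Suc n := d)"
  have eq: "(\<Sum>i<n. g (y i) (y (Suc i))) = (\<Sum>i<n. g (x i) (x (Suc i)))"
    by (intro sum.cong) (auto simp: y_def)
  have "interval_partition a d (Suc n) y"
    using assms(1) True by (auto simp: interval_partition_def y_def less_Suc_eq)
  moreover have "(\<Sum>i<Suc n. g (y i) (y (Suc i))) = (\<Sum>i<n. g (x i) (x (Suc i))) + g c d"
    using assms(1) by (simp add: eq) (simp add: y_def interval_partition_def)
  ultimately show ?thesis using True that by force
next
  case False
  then show ?thesis using assms that[of n x] by auto
qed

text \<open>Induction on the number of intervals, removing the rightmost one: a partition up to its left end is
  continued by its right end and by \<open>b\<close>. The gaps only add nonnegative terms.\<close>

lemma disjoint_intervals_in_partition: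
  fixes g :: "real \<Rightarrow> real \<Rightarrow> real"
  assumes "finite S" "a \<le> b" and nonneg: "\<And>u v. 0 \<le> g u v"
    and "\<And>i. i \<in> S \<Longrightarrow> a \<le> u i \<and> u i < v i \<and> v i \<le> b"
    and "\<And>i j. i \<in> S \<Longrightarrow> j \<in> S \<Longrightarrow> i \<noteq> j \<Longrightarrow> v i \<le> u j \<or> v j \<le> u i"
  shows "\<exists>n x. interval_partition a b n x \<and> (\<Sum>i\<in>S. g (u i) (v i)) \<le> (\<Sum>i<n. g (x i) (x (Suc i)))"
  using assms(1,2,4,5)
proof (induction "card S" arbitrary: S b)
  case 0
  then have "S = {}" by simp
  obtain n x where "interval_partition a b n x"
    using interval_partition_extend[of a a 0 "\<lambda>_. a" b "\<lambda>_ _. 0"] 0(3)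
    by (auto simp: interval_partition_def)
  with \<open>S = {}\<close> show ?case using nonneg by (auto intro!: exI sum_nonneg)
next
  case (Suc m)
  then have "S \<noteq> {}" by auto
  define k where "k = arg_min_on (\<lambda>i. - u i) S"
  have k: "k \<in> S" and k_max: "\<And>i. i \<in> S \<Longrightarrow> u i \<le> u k"
    using arg_min_if_finite[OF Suc.prems(1) \<open>S \<noteq> {}\<close>, of "\<lambda>i. - u i"]
      arg_min_least[OF Suc.prems(1) \<open>S \<noteq> {}\<close>, of _ "\<lambda>i. - u i"] by (auto simp: k_def)
  have left: "v i \<le> u k" if "i \<in> S - {k}" for i
    using Suc.prems(3)[of i] Suc.prems(3)[OF k] Suc.prems(4)[of i k] k k_max[of i] that by auto
  have "\<exists>n x. interval_partition a (u k) n x \<and> (\<Sum>i\<in>S - {k}. g (u i) (v i)) \<le> (\<Sum>i<n. g (x i) (x (Suc i)))"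
  proof (rule Suc.hyps(1))
    show "m = card (S - {k})" using Suc.hyps(2) Suc.prems(1) k by simp
  qed (use Suc.prems left k in auto)
  then obtain n x where x: "interval_partition a (u k) n x"
    "(\<Sum>i\<in>S - {k}. g (u i) (v i)) \<le> (\<Sum>i<n. g (x i) (x (Suc i)))" by blast
  have uv: "u k < v k" "v k \<le> b" using Suc.prems(3)[OF k] by auto
  obtain n1 x1 where x1: "interval_partition a (v k) n1 x1"
    "(\<Sum>i<n. g (x i) (x (Suc i))) + g (u k) (v k) \<le> (\<Sum>i<n1. g (x1 i) (x1 (Suc i)))"
    using interval_partition_extend[of a "u k" n x "v k" g] x(1) uv nonneg by auto
  obtain n2 x2 where x2: "interval_partition a b n2 x2"
    "(\<Sum>i<n1. g (x1 i) (x1 (Suc i))) + (if v k < b then g (v k) b else 0) \<le> (\<Sum>i<n2. g (x2 i) (x2 (Suc i)))"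
    using interval_partition_extend[of a "v k" n1 x1 b g] x1(1) uv nonneg by blast
  have "(\<Sum>i\<in>S. g (u i) (v i)) = g (u k) (v k) + (\<Sum>i\<in>S - {k}. g (u i) (v i))"
    using Suc.prems(1) k by (rule sum.remove)
  also have "\<dots> \<le> (\<Sum>i<n2. g (x2 i) (x2 (Suc i)))"
    using x(2) x1(2) x2(2) nonneg[of "v k" b] by (auto split: if_splits)
  finally show ?case using x2(1) by blast
qed

lemma disjoint_intervals_sum_le:
  fixes g :: "real \<Rightarrow> real \<Rightarrow> real"
  assumes "\<And>n x. interval_partition a b n x \<Longrightarrow> (\<Sum>i<n. g (x i) (x (Suc i))) \<le> B"
    and "finite S" "a \<le> b" and "\<And>u v. 0 \<le> g u v"
    and "\<And>i. i \<in> S \<Longrightarrow> a \<le> u i \<and> u i < v i \<and> v i \<le> b"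
    and "\<And>i j. i \<in> S \<Longrightarrow> j \<in> S \<Longrightarrow> i \<noteq> j \<Longrightarrow> v i \<le> u j \<or> v j \<le> u i"
  shows "(\<Sum>i\<in>S. g (u i) (v i)) \<le> B"
  using disjoint_intervals_in_partition[of S a b g u v, OF assms(2-6)] assms(1) by (meson order_trans)

section \<open>Distortion of cross-ratios\<close>

text \<open>The term \<open>y\<close> on the right is what makes this useful: it integrates to 0 over an interval
  centred at 0.\<close>

lemma exp_le_self_plus_exp_square: "exp y \<le> y + exp (y\<^sup>2)" for y :: real
proof -
  have sq: "1 + y\<^sup>2 \<le> exp (y\<^sup>2)" by (rule exp_ge_add_one_self)
  consider "0 \<le> y" "y \<le> 1" | "1 \<le> y" | "y \<le> 0" by linarith
  then show ?thesis
  proof cases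
    case 1
    then show ?thesis using exp_bound[of y] sq by linarith
  next
    case 2
    then have "y \<le> y\<^sup>2" by (simp add: power2_eq_square)
    then show ?thesis using 2 exp_le_cancel_iff[of y "y\<^sup>2"] by linarith
  next
    case 3
    have "(1 - y) * exp y \<le> 1"
    proof -
      have "(1 - y) * exp y \<le> exp (- y) * exp y"
        using exp_ge_add_one_self[of "- y"] by (intro mult_right_mono) auto
      then show ?thesis by (simp flip: exp_add)
    qed
    also have "1 \<le> (1 - y) * (1 + y + y\<^sup>2)"
    proof -
      have "y ^ 3 \<le> 0" using 3 by (simp add: power_le_zero_eq)
      then show ?thesis by (simp add: algebra_simps power2_eq_square power3_eq_cube)
    qed
    finally have "exp y \<le> 1 + y + y\<^sup>2"
      using 3 by (subst (asm) mult_le_cancel_left_pos) auto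
    with sq show ?thesis by linarith
  qed
qed

text \<open>The slope is the mean of \<open>exp \<phi>\<close>. Around the midpoint \<open>m\<close> the exponential of an affine function lies
  between two functions that differ from constants by odd terms, so their means are explicit:
  with \<open>y = \<kappa> * (x - m)\<close> these are \<open>1 + y \<le> exp y \<le> y + exp (y\<^sup>2)\<close>. The error is therefore quadratic
  in the increment of the affine function; comparing derivatives avoids the integrals.\<close>

lemma slope_close_to_affine:
  fixes F \<phi> :: "real \<Rightarrow> real"
  assumes "u < v"
    and der: "\<And>x. u \<le> x \<Longrightarrow> x \<le> v \<Longrightarrow> (F has_real_derivative exp (\<phi> x)) (at x)"
    and close: "\<And>x. u \<le> x \<Longrightarrow> x \<le> v \<Longrightarrow> \<bar>\<phi> x - (c + \<kappa> * x)\<bar> \<le> M"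
  shows "\<bar>ln ((F v - F u) / (v - u)) - (c + \<kappa> * ((u + v) / 2))\<bar> \<le> M + (\<kappa> * (v - u) / 2)\<^sup>2"
proof -
  define m where "m = (u + v) / 2"
  define l where "l = c + \<kappa> * m"
  define w where "w = \<kappa> * (v - u) / 2"
  define y where "y x = \<kappa> * (x - m)" for x
  have y: "c + \<kappa> * x = l + y x" for x by (simp add: y_def l_def algebra_simps)
  have sq: "(u - m)\<^sup>2 = (v - m)\<^sup>2"
    by (simp add: m_def power2_eq_square field_simps)
  have yw: "(y x)\<^sup>2 \<le> w\<^sup>2" if "u \<le> x" "x \<le> v" for x
  proof -
    have "\<bar>x - m\<bar> \<le> (v - u) / 2" using that by (auto simp: m_def abs_le_iff field_simps)
    then have "\<bar>y x\<bar> \<le> \<bar>w\<bar>"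
      using mult_left_mono[of "\<bar>x - m\<bar>" "(v - u) / 2" "\<bar>\<kappa>\<bar>"] assms(1)
      by (simp add: y_def w_def abs_mult)
    then show ?thesis by (simp add: abs_le_square_iff)
  qed
  have lower: "exp (l - M) * (1 + y x) \<le> exp (\<phi> x)" and upper: "exp (\<phi> x) \<le> exp (l + M) * (y x + exp (w\<^sup>2))"
    if x: "u \<le> x" "x \<le> v" for x
  proof -
    have "exp (l - M) * (1 + y x) \<le> exp (l - M) * exp (y x)"
      by (intro mult_left_mono exp_ge_add_one_self) simp
    also have "\<dots> = exp (l + y x - M)" by (simp flip: exp_add add: algebra_simps)
    also have "\<dots> \<le> exp (\<phi> x)" using close[OF x] by (simp add: y abs_le_iff)
    finally show "exp (l - M) * (1 + y x) \<le> exp (\<phi> x)" .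
    have "exp (\<phi> x) \<le> exp (l + M + y x)" using close[OF x] by (simp add: y abs_le_iff)
    also have "\<dots> = exp (l + M) * exp (y x)" by (simp flip: exp_add)
    also have "\<dots> \<le> exp (l + M) * (y x + exp (w\<^sup>2))"
      using exp_le_self_plus_exp_square[of "y x"] yw[OF x] by (intro mult_left_mono) (auto intro: order_trans)
    finally show "exp (\<phi> x) \<le> exp (l + M) * (y x + exp (w\<^sup>2))" .
  qed
  have "F u - exp (l - M) * (u + \<kappa> * (u - m)\<^sup>2 / 2) \<le> F v - exp (l - M) * (v + \<kappa> * (v - m)\<^sup>2 / 2)"
  proof (rule DERIV_nonneg_imp_nondecreasing[where f = "\<lambda>x. F x - exp (l - M) * (x + \<kappa> * (x - m)\<^sup>2 / 2)"])
    show "u \<le> v" using assms(1) by simp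
    show "\<exists>d. ((\<lambda>x. F x - exp (l - M) * (x + \<kappa> * (x - m)\<^sup>2 / 2)) has_real_derivative d) (at x) \<and> 0 \<le> d"
      if "u \<le> x" "x \<le> v" for x
    proof (intro exI conjI)
      show "((\<lambda>x. F x - exp (l - M) * (x + \<kappa> * (x - m)\<^sup>2 / 2)) has_real_derivative
          exp (\<phi> x) - exp (l - M) * (1 + y x)) (at x)"
        by (rule derivative_eq_intros der[OF that] refl | simp add: y_def)+
    qed (use lower[OF that] in simp)
  qed
  then have lo: "exp (l - M) * (v - u) \<le> F v - F u"
    by (simp add: sq algebra_simps)
  have "exp (l + M) * (exp (w\<^sup>2) * u + \<kappa> * (u - m)\<^sup>2 / 2) - F u
      \<le> exp (l + M) * (exp (w\<^sup>2) * v + \<kappa> * (v - m)\<^sup>2 / 2) - F v"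
  proof (rule DERIV_nonneg_imp_nondecreasing
      [where f = "\<lambda>x. exp (l + M) * (exp (w\<^sup>2) * x + \<kappa> * (x - m)\<^sup>2 / 2) - F x"])
    show "u \<le> v" using assms(1) by simp
    show "\<exists>d. ((\<lambda>x. exp (l + M) * (exp (w\<^sup>2) * x + \<kappa> * (x - m)\<^sup>2 / 2) - F x) has_real_derivative d) (at x) \<and> 0 \<le> d"
      if "u \<le> x" "x \<le> v" for x
    proof (intro exI conjI)
      show "((\<lambda>x. exp (l + M) * (exp (w\<^sup>2) * x + \<kappa> * (x - m)\<^sup>2 / 2) - F x) has_real_derivative
          exp (l + M) * (y x + exp (w\<^sup>2)) - exp (\<phi> x)) (at x)"
        by (rule derivative_eq_intros der[OF that] refl | simp add: y_def)+
    qed (use upper[OF that] in simp)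
  qed
  then have hi: "F v - F u \<le> exp (l + M) * (exp (w\<^sup>2) * (v - u))"
    by (simp add: sq algebra_simps)
  define r where "r = (F v - F u) / (v - u)"
  have r: "exp (l - M) \<le> r" "r \<le> exp (l + M + w\<^sup>2)"
    using lo hi assms(1) by (auto simp: r_def field_simps exp_add)
  then have "r > 0" by (meson exp_gt_zero less_le_trans)
  then have "l - M \<le> ln r" "ln r \<le> l + M + w\<^sup>2"
    using r by (auto simp: ln_ge_iff ln_le_cancel_iff[of r "exp (l + M + w\<^sup>2)", simplified])
  moreover have "w\<^sup>2 \<ge> 0" by simp
  ultimately show ?thesis unfolding r_def w_def l_def m_def by (simp only: abs_le_iff) linarith
qed

text \<open>The deviation \<open>\<psi>\<close> from the affine interpolant vanishes at the end points and has the same second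
  differences as \<open>\<phi>\<close>, because these annihilate affine functions. At a point where \<open>\<bar>\<psi>\<bar>\<close> is
  largest, a suitable second difference is at least as large.\<close>

lemma affine_interpolation_error:
  fixes \<phi> :: "real \<Rightarrow> real"
  assumes "s < t" and cont: "continuous_on {s..t} \<phi>"
  obtains u v where "s \<le> u" "u < v" "v \<le> t"
    and "\<And>x. s \<le> x \<Longrightarrow> x \<le> t \<Longrightarrow>
      \<bar>\<phi> x - (\<phi> s + (\<phi> t - \<phi> s) / (t - s) * (x - s))\<bar> \<le> \<bar>\<phi> u + \<phi> v - 2 * \<phi> ((u + v) / 2)\<bar>"
proof -
  define \<psi> where "\<psi> x = \<phi> x - (\<phi> s + (\<phi> t - \<phi> s) / (t - s) * (x - s))" for x
  have ends: "\<psi> s = 0" "\<psi> t = 0" using assms(1) by (auto simp: \<psi>_def)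
  have second: "\<psi> u + \<psi> v - 2 * \<psi> ((u + v) / 2) = \<phi> u + \<phi> v - 2 * \<phi> ((u + v) / 2)" for u v
  proof -
    define \<kappa> where "\<kappa> = (\<phi> t - \<phi> s) / (t - s)"
    show ?thesis unfolding \<psi>_def \<kappa>_def[symmetric] by (simp add: algebra_simps) 
  qed
  have "continuous_on {s..t} (\<lambda>x. \<bar>\<psi> x\<bar>)"
    unfolding \<psi>_def by (intro continuous_intros cont)
  then obtain p where p: "s \<le> p" "p \<le> t" and max: "\<And>x. s \<le> x \<Longrightarrow> x \<le> t \<Longrightarrow> \<bar>\<psi> x\<bar> \<le> \<bar>\<psi> p\<bar>"
    using continuous_attains_sup[of "{s..t}" "\<lambda>x. \<bar>\<psi> x\<bar>"] assms(1) by (auto simp: Ball_def)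
  \<comment> \<open>Reflect the nearer end point in \<open>p\<close>: the second difference over the resulting interval
     is at least \<open>2 * \<bar>\<psi> p\<bar> - 0 - \<bar>\<psi> p\<bar>\<close>.\<close>
  have "\<exists>u v. s \<le> u \<and> u < v \<and> v \<le> t \<and> \<bar>\<psi> p\<bar> \<le> \<bar>\<psi> u + \<psi> v - 2 * \<psi> ((u + v) / 2)\<bar>"
  proof (cases "p = s \<or> p = t")
    case True
    then show ?thesis using ends assms(1) by (intro exI[of _ s] exI[of _ t]) auto
  next
    case False
    show ?thesis
    proof (cases "p - s \<le> t - p")
      case True
      have "\<bar>\<psi> (2 * p - s)\<bar> \<le> \<bar>\<psi> p\<bar>" using True p by (intro max) auto
      then show ?thesis using True False p ends
        by (intro exI[of _ s] exI[of _ "2 * p - s"]) auto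
    next
      case no: False
      have "\<bar>\<psi> (2 * p - t)\<bar> \<le> \<bar>\<psi> p\<bar>" using no p by (intro max) auto
      then show ?thesis using no False p ends
        by (intro exI[of _ "2 * p - t"] exI[of _ t]) auto
    qed
  qed
  then obtain u v where uv: "s \<le> u" "u < v" "v \<le> t" 
    "\<bar>\<psi> p\<bar> \<le> \<bar>\<psi> u + \<psi> v - 2 * \<psi> ((u + v) / 2)\<bar>" by blast
  show ?thesis
  proof (rule that[OF uv(1-3)])
    fix x assume "s \<le> x" "x \<le> t"
    then show "\<bar>\<phi> x - (\<phi> s + (\<phi> t - \<phi> s) / (t - s) * (x - s))\<bar> \<le> \<bar>\<phi> u + \<phi> v - 2 * \<phi> ((u + v) / 2)\<bar>"
      using max[of x] uv(4) unfolding second unfolding \<psi>_def by linarith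
  qed
qed

text \<open>The product of the lengths of the outer intervals, divided by that of the middle and the total
  interval. Small values mean that the middle interval is long compared with one of its
  neighbours.\<close>

definition log_cross_ratio :: "real \<Rightarrow> real \<Rightarrow> real \<Rightarrow> real \<Rightarrow> real" where
  "log_cross_ratio a b c d = ln (b - a) + ln (d - c) - ln (c - b) - ln (d - a)"

lemma log_cross_ratio_distortion:
  fixes F :: "real \<Rightarrow> real"
  assumes ord: "a < b" "b < c" "c < d"
    and mono: "strict_mono F"
  shows "log_cross_ratio (F a) (F b) (F c) (F d) - log_cross_ratio a b c d =
    ln ((F b - F a) / (b - a)) + ln ((F d - F c) / (d - c))
      - ln ((F c - F b) / (c - b)) - ln ((F d - F a) / (d - a))"
proof -
  have "F a < F b" "F b < F c" "F c < F d"
    using ord mono by (auto simp: strict_mono_def)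
  then show ?thesis using ord by (simp add: log_cross_ratio_def ln_div)
qed

text \<open>The four slopes are compared with one and the same affine function, at the four midpoints. Their
  alternating sum vanishes, as \<open>(a + b) + (c + d) = (b + c) + (a + d)\<close>, so that only the errors remain:
  no first difference of \<open>\<phi>\<close> enters to first order.\<close>

lemma log_cross_ratio_distortion_bound:
  fixes F \<phi> :: "real \<Rightarrow> real"
  assumes ord: "a < b" "b < c" "c < d"
    and mono: "strict_mono F"
    and der: "\<And>x. (F has_real_derivative exp (\<phi> x)) (at x)"
    and cont: "continuous_on UNIV \<phi>"
  obtains u v where "a \<le> u" "u < v" "v \<le> d"
    and "\<bar>log_cross_ratio (F a) (F b) (F c) (F d) - log_cross_ratio a b c d\<bar>
      \<le> 4 * \<bar>\<phi> u + \<phi> v - 2 * \<phi> ((u + v) / 2)\<bar> + (\<phi> d - \<phi> a)\<^sup>2"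
proof -
  define \<kappa> where "\<kappa> = (\<phi> d - \<phi> a) / (d - a)"
  define c0 where "c0 = \<phi> a - \<kappa> * a"
  obtain u v where uv: "a \<le> u" "u < v" "v \<le> d"
    and err: "\<And>x. a \<le> x \<Longrightarrow> x \<le> d \<Longrightarrow>
      \<bar>\<phi> x - (\<phi> a + \<kappa> * (x - a))\<bar> \<le> \<bar>\<phi> u + \<phi> v - 2 * \<phi> ((u + v) / 2)\<bar>"
    unfolding \<kappa>_def
    by (rule affine_interpolation_error[of a d \<phi>])
      (use ord continuous_on_subset[OF cont subset_UNIV] in auto)
  then have close: "\<bar>\<phi> x - (c0 + \<kappa> * x)\<bar> \<le> \<bar>\<phi> u + \<phi> v - 2 * \<phi> ((u + v) / 2)\<bar>"
    if "a \<le> x" "x \<le> d" for x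
  proof -
    have "c0 + \<kappa> * x = \<phi> a + \<kappa> * (x - a)" by (simp add: c0_def algebra_simps)
    with that show ?thesis using err by simp
  qed
  define M where "M = \<bar>\<phi> u + \<phi> v - 2 * \<phi> ((u + v) / 2)\<bar>"
  have slope: "\<bar>ln ((F y - F x) / (y - x)) - (c0 + \<kappa> * ((x + y) / 2))\<bar> \<le> M + (\<phi> d - \<phi> a)\<^sup>2 / 4"
    if "a \<le> x" "x < y" "y \<le> d" for x y
  proof -
    have "\<bar>ln ((F y - F x) / (y - x)) - (c0 + \<kappa> * ((x + y) / 2))\<bar> \<le> M + (\<kappa> * (y - x) / 2)\<^sup>2"
      unfolding M_def by (rule slope_close_to_affine[where \<phi> = \<phi>]) (use that der close in auto)
    also have "(\<kappa> * (y - x) / 2)\<^sup>2 \<le> (\<kappa> * (d - a) / 2)\<^sup>2"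
      unfolding abs_le_square_iff[symmetric] using that
      by (auto simp: abs_mult intro!: mult_left_mono)
    also have "\<kappa> * (d - a) / 2 = (\<phi> d - \<phi> a) / 2" using ord by (simp add: \<kappa>_def)
    also have "\<dots>\<^sup>2 = (\<phi> d - \<phi> a)\<^sup>2 / 4" by (simp add: power_divide)
    finally show ?thesis by simp
  qed
  have mid: "(c0 + \<kappa> * ((a + b) / 2)) + (c0 + \<kappa> * ((c + d) / 2))
      - (c0 + \<kappa> * ((b + c) / 2)) - (c0 + \<kappa> * ((a + d) / 2)) = 0"
    by (simp add: algebra_simps add_divide_distrib)
  have four: "\<bar>s1 + s2 - s3 - s4\<bar> \<le> 4 * e"
    if "\<bar>s1 - m1\<bar> \<le> e" "\<bar>s2 - m2\<bar> \<le> e" "\<bar>s3 - m3\<bar> \<le> e" "\<bar>s4 - m4\<bar> \<le> e" "m1 + m2 - m3 - m4 = 0"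
    for s1 s2 s3 s4 m1 m2 m3 m4 e :: real
    using that by linarith
  have "\<bar>log_cross_ratio (F a) (F b) (F c) (F d) - log_cross_ratio a b c d\<bar> \<le> 4 * (M + (\<phi> d - \<phi> a)\<^sup>2 / 4)"
    unfolding log_cross_ratio_distortion[OF ord mono]
    by (rule four[OF slope[of a b] slope[of c d] slope[of b c] slope[of a d] mid]) (use ord in auto)
  then show ?thesis using that[OF uv] by (simp add: M_def)
qed

section \<open>Semiconjugacy of a lift to a translation\<close>

lemma degree_one_surj:
  fixes G :: "real \<Rightarrow> real"
  assumes "continuous_on UNIV G" and shift: "\<And>x. G (x + 1) = G x + 1"
  shows "surj G"
  unfolding surj_def
proof
  fix y
  have "G (0 + of_int \<lfloor>y - G 0\<rfloor>) \<le> y" "y \<le> G (0 + of_int \<lceil>y - G 0\<rceil>)"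
    unfolding degree_one_add_of_int[of G, OF shift] by linarith+
  moreover have "(of_int \<lfloor>y - G 0\<rfloor> :: real) \<le> of_int \<lceil>y - G 0\<rceil>"
    by (meson ceiling_le_iff floor_le_ceiling of_int_le_iff)
  ultimately show "\<exists>x. y = G x"
    using IVT'[of G "of_int \<lfloor>y - G 0\<rfloor>" y "of_int \<lceil>y - G 0\<rceil>"]
      continuous_on_subset[OF assms(1)] by auto
qed

locale circle_lift =
  fixes F :: "real \<Rightarrow> real" and \<alpha> :: real
  assumes continuous: "continuous_on UNIV F"
    and strict_mono: "strict_mono F"
    and shift: "F (x + 1) = F x + 1"
    and irrational: "\<alpha> \<notin> \<rat>"
    and translation: "(\<lambda>n. ((F ^^ n) x - x) / real n) \<longlonglongrightarrow> \<alpha>"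
begin

lemma bij: "bij F"
  using strict_mono_imp_inj_on[OF strict_mono] degree_one_surj[OF continuous shift] by (rule bijI)

text \<open>Negative iterates are included so that shifting the index is a bijection of the index set in the
  supremum that defines the semiconjugacy.\<close>

definition iter :: "int \<Rightarrow> real \<Rightarrow> real" where
  "iter i = (if 0 \<le> i then F ^^ nat i else inv F ^^ nat (- i))"

lemma iter_of_nat: "iter (int n) = F ^^ n"
  by (simp add: iter_def)

lemma iter_0 [simp]: "iter 0 x = x"
  by (simp add: iter_def)

lemma iter_succ: "iter (i + 1) x = F (iter i x)"
proof (cases "0 \<le> i")
  case True
  then have "nat (i + 1) = Suc (nat i)" by simp
  with True show ?thesis by (simp add: iter_def)
next
  case False
  then have eq: "nat (- i) = Suc (nat (- (i + 1)))" by simp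
  have "F (iter i x) = (inv F ^^ nat (- (i + 1))) x"
    using False bij by (simp add: iter_def eq surj_f_inv_f[OF bij_is_surj] del: minus_add_distrib)
  then show ?thesis using False by (auto simp: iter_def)
qed

lemma iter_add: "iter (i + j) x = iter i (iter j x)"
proof (induction i rule: int_induct[where k = 0])
  case (step1 i)
  then show ?case by (metis add.commute add.left_commute iter_succ)
next
  case (step2 i)
  have "F (iter (i - 1 + j) x) = F (iter (i - 1) (iter j x))"
    using step2 iter_succ[of "i - 1 + j" x] iter_succ[of "i - 1" "iter j x"] by simp
  then show ?case using bij by (simp add: bij_is_inj inj_eq)
qed simp

lemma iter_minus_cancel [simp]: "iter (- i) (iter i x) = x" "iter i (iter (- i) x) = x"
  by (simp_all flip: iter_add)

lemma iter_shift: "iter i (x + of_int k) = iter i x + of_int k"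
proof (induction i rule: int_induct[where k = 0])
  case (step1 i)
  then show ?case by (simp add: iter_succ degree_one_add_of_int[of F, OF shift])
next
  case (step2 i)
  have "F (iter (i - 1) (x + of_int k)) = F (iter (i - 1) x + of_int k)"
    using step2 iter_succ[of "i - 1" x] iter_succ[of "i - 1" "x + of_int k"]
    by (simp add: degree_one_add_of_int[of F, OF shift])
  then show ?case using bij by (simp add: bij_is_inj inj_eq)
qed simp

lemma iter_strict_mono: "strict_mono (iter i)"
proof (induction i rule: int_induct[where k = 0])
  case base
  show ?case by (simp add: strict_mono_def)
next
  case (step1 i)
  then show ?case using strict_mono by (simp add: strict_mono_def iter_succ)
next
  case (step2 i)
  have "iter (i - 1) x < iter (i - 1) y" if "x < y" for x y
  proof -
    have "F (iter (i - 1) x) < F (iter (i - 1) y)"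
      using strict_monoD[OF step2(2) that] iter_succ[of "i - 1" x] iter_succ[of "i - 1" y] by simp
    then show ?thesis by (simp add: strict_mono_less[OF strict_mono])
  qed
  then show ?case by (rule strict_monoI)
qed

lemma iter_continuous: "continuous_on UNIV (iter i)"
proof (rule continuous_onI_mono)
  have "surj (iter i)" by (rule surjI[of _ "iter (- i)"]) simp
  then show "open (iter i ` UNIV)" by simp
  show "iter i x \<le> iter i y" if "x \<le> y" for x y
    using that iter_strict_mono by (simp add: strict_mono_less_eq)
qed

text \<open>Displacements of \<open>F ^^ n\<close> at different points differ by at most 1. Hence \<open>m\<close> iterations of \<open>F ^^ n\<close>
  displace a point by \<open>m\<close> times its first displacement up to the error \<open>m\<close>; divide by \<open>m\<close> and let
  \<open>m\<close> tend to infinity.\<close>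

lemma funpow_displacement: "\<bar>(F ^^ n) x - x - real n * \<alpha>\<bar> \<le> 1"
proof (cases "n = 0")
  case False
  define s where "s m = ((F ^^ (m * n)) x - x) / real m" for m :: nat
  have "strict_mono (\<lambda>m. m * n)" using False by (simp add: strict_mono_def)
  then have "(\<lambda>m. ((F ^^ (m * n)) x - x) / real (m * n)) \<longlonglongrightarrow> \<alpha>"
    using LIMSEQ_subseq_LIMSEQ[OF translation, of "\<lambda>m. m * n" x] by (simp add: o_def)
  then have "(\<lambda>m. real n * (((F ^^ (m * n)) x - x) / real (m * n))) \<longlonglongrightarrow> real n * \<alpha>"
    by (intro tendsto_intros)
  moreover have "real n * (((F ^^ (m * n)) x - x) / real (m * n)) = s m" for m
    using False by (simp add: s_def)
  ultimately have lim: "s \<longlonglongrightarrow> real n * \<alpha>" by simp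
  have mono: "mono (F ^^ n)" and deg: "(F ^^ n) (y + 1) = (F ^^ n) y + 1" for y
    using strict_mono_mono[OF iter_strict_mono, of "int n"] iter_shift[of "int n" y 1]
    by (simp_all add: iter_of_nat)
  have "\<bar>(F ^^ (m * n)) x - x - real m * ((F ^^ n) x - x)\<bar> \<le> real m" for m
  proof (induction m)
    case (Suc m)
    have "(F ^^ (Suc m * n)) x = (F ^^ n) ((F ^^ (m * n)) x)"
      by (simp add: funpow_add)
    then show ?case
      using Suc degree_one_displacement[OF mono deg, of "(F ^^ (m * n)) x" x]
      by (simp add: algebra_simps)
  qed simp
  then have bound: "\<bar>s m - ((F ^^ n) x - x)\<bar> \<le> 1" if "m > 0" for m
  proof -
    assume *: "\<And>m. \<bar>(F ^^ (m * n)) x - x - real m * ((F ^^ n) x - x)\<bar> \<le> real m"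
    have "s m - ((F ^^ n) x - x) = ((F ^^ (m * n)) x - x - real m * ((F ^^ n) x - x)) / real m"
      using that by (simp add: s_def field_simps)
    then show ?thesis using *[of m] that by (simp add: abs_div)
  qed
  have "(\<lambda>m. \<bar>s m - ((F ^^ n) x - x)\<bar>) \<longlonglongrightarrow> \<bar>real n * \<alpha> - ((F ^^ n) x - x)\<bar>"
    by (intro tendsto_intros lim)
  then have "\<bar>real n * \<alpha> - ((F ^^ n) x - x)\<bar> \<le> 1"
    by (rule LIMSEQ_le_const2) (use bound in \<open>auto intro!: exI[of _ 1]\<close>)
  then show ?thesis by (simp add: abs_minus_commute)
qed simp

lemma iter_displacement: "\<bar>iter i x - x - of_int i * \<alpha>\<bar> \<le> 1"
proof (cases "0 \<le> i")
  case True
  then show ?thesis using funpow_displacement[of "nat i" x] iter_of_nat[of "nat i"] by simp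
next
  case False
  define y where "y = iter i x"
  have "x = iter (- i) y" by (simp add: y_def)
  moreover have "iter (- i) = F ^^ nat (- i)" using False by (simp add: iter_def)
  ultimately have "\<bar>x - y - real (nat (- i)) * \<alpha>\<bar> \<le> 1"
    using funpow_displacement[of "nat (- i)" y] by simp
  then show ?thesis using False by (simp add: y_def)
qed

text \<open>Each term satisfies the functional equation of a semiconjugacy up to a shift of the index, so the
  supremum over all integers satisfies it exactly.\<close>

definition semiconj :: "real \<Rightarrow> real" where
  "semiconj x = (SUP i. iter i x - of_int i * \<alpha>)"

lemma semiconj_bdd: "bdd_above (range (\<lambda>i. iter i x - of_int i * \<alpha>))"
proof (rule bdd_aboveI2)
  show "iter i x - of_int i * \<alpha> \<le> x + 1" for i
    using iter_displacement[of i x] by linarith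
qed

lemma semiconj_upper: "iter i x - of_int i * \<alpha> \<le> semiconj x"
  unfolding semiconj_def by (rule cSUP_upper[OF UNIV_I semiconj_bdd])

lemma semiconj_iter: "semiconj (iter j x) = semiconj x + of_int j * \<alpha>"
proof -
  have le: "semiconj (iter j x) \<le> semiconj x + of_int j * \<alpha>" for j x
    unfolding semiconj_def[of "iter j x"]
  proof (rule cSUP_least)
    show "iter i (iter j x) - of_int i * \<alpha> \<le> semiconj x + of_int j * \<alpha>" for i
      using semiconj_upper[of "i + j" x] by (simp add: iter_add algebra_simps)
  qed simp
  show ?thesis using le[of j x] le[of "- j" "iter j x"] by simp
qed

lemma semiconj_shift: "semiconj (x + of_int k) = semiconj x + of_int k"
proof -
  have le: "semiconj (x + of_int k) \<le> semiconj x + of_int k" for x k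
    unfolding semiconj_def[of "x + of_int k"]
  proof (rule cSUP_least)
    show "iter i (x + of_int k) - of_int i * \<alpha> \<le> semiconj x + of_int k" for i
      using semiconj_upper[of i x] by (simp add: iter_shift algebra_simps)
  qed simp
  show ?thesis using le[of x k] le[of "x + of_int k" "- k"] by simp
qed

lemma semiconj_mono: "mono semiconj"
proof (rule monoI)
  fix x y :: real assume "x \<le> y"
  then have "iter i x \<le> iter i y" for i
    using iter_strict_mono by (simp add: strict_mono_less_eq)
  then have "iter i x - of_int i * \<alpha> \<le> semiconj y" for i
    using semiconj_upper[of i y] by (meson diff_right_mono order_trans)
  then show "semiconj x \<le> semiconj y"
    unfolding semiconj_def[of x] by (intro cSUP_least) auto
qed

lemma semiconj_dense:
  assumes "y < z"
  obtains x where "y < semiconj x" "semiconj x < z"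
proof -
  define m where "m = (y + z) / 2 - semiconj 0"
  obtain i :: nat and k :: int
    where "0 \<le> m - (real i * \<alpha> + of_int k)" "m - (real i * \<alpha> + of_int k) < (z - y) / 2"
  proof (rule rotation_combinatorics[OF irrational])
    show "0 < (z - y) / 2" using assms by simp
  next
    fix N :: nat and \<epsilon> :: real
    assume "\<epsilon> < (z - y) / 2"
      and "\<And>z. \<exists>i < 2 * N. \<exists>k :: int. 0 \<le> z - (real i * \<alpha> + of_int k) \<and> z - (real i * \<alpha> + of_int k) < \<epsilon>"
    then show thesis using that by (meson order.strict_trans)
  qed
  moreover have "semiconj (iter (int i) 0 + of_int k) = semiconj 0 + real i * \<alpha> + of_int k"
    by (simp add: semiconj_shift semiconj_iter)
  ultimately show ?thesis
    using assms by (intro that[of "iter (int i) 0 + of_int k"]) (auto simp: m_def field_simps)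
qed

text \<open>A monotone function with dense image has no jumps.\<close>

lemma semiconj_continuous: "continuous_on UNIV semiconj"
proof -
  have "isCont semiconj x" for x
    unfolding continuous_at_eps_delta
  proof (intro allI impI)
    fix e :: real assume "e > 0"
    obtain a where a: "semiconj x - e < semiconj a" "semiconj a < semiconj x"
      using semiconj_dense[of "semiconj x - e" "semiconj x"] \<open>e > 0\<close> by auto
    obtain b where b: "semiconj x < semiconj b" "semiconj b < semiconj x + e"
      using semiconj_dense[of "semiconj x" "semiconj x + e"] \<open>e > 0\<close> by auto
    have "a < x" "x < b"
      using a b semiconj_mono by (meson monoD not_le)+
    moreover have "dist (semiconj y) (semiconj x) < e" if "dist y x < min (x - a) (b - x)" for y
    proof -
      have "a \<le> y" "y \<le> b" using that by (auto simp: dist_real_def)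
      then have "semiconj a \<le> semiconj y" "semiconj y \<le> semiconj b"
        using semiconj_mono by (auto dest: monoD)
      then show ?thesis using a b by (simp add: dist_real_def abs_less_iff)
    qed
    ultimately show "\<exists>d>0. \<forall>y. dist y x < d \<longrightarrow> dist (semiconj y) (semiconj x) < e"
      by (intro exI[of _ "min (x - a) (b - x)"]) auto
  qed
  then show ?thesis by (simp add: continuous_at_imp_continuous_on)
qed

lemma less_of_semiconj_less: "semiconj x < semiconj y \<Longrightarrow> x < y"
  using semiconj_mono by (meson monoD not_le)

end

section \<open>Cross-ratios along closest returns\<close>

text \<open>The function \<open>\<phi>\<close> is the logarithm of the derivative of \<open>F\<close>. The constants are kept explicit, because
  the bounds below have to be uniform over all closest returns.\<close>

locale denjoy_lift = circle_lift +
  fixes \<phi> :: "real \<Rightarrow> real" and K Bz Bq :: real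
  assumes der: "(F has_real_derivative exp (\<phi> x)) (at x)"
    and phi_continuous: "continuous_on UNIV \<phi>"
    and phi_bound: "\<bar>\<phi> x\<bar> \<le> K"
    and zygmund: "interval_partition 0 1 n z \<Longrightarrow>
      (\<Sum>i<n. \<bar>\<phi> (z i) + \<phi> (z (Suc i)) - 2 * \<phi> ((z i + z (Suc i)) / 2)\<bar>) \<le> Bz"
    and quadratic: "interval_partition 0 1 n z \<Longrightarrow> (\<Sum>i<n. (\<phi> (z (Suc i)) - \<phi> (z i))\<^sup>2) \<le> Bq"
begin

lemma K_nonneg: "0 \<le> K"
  using phi_bound[of 0] by linarith

lemma ln_slope_bound:
  assumes "x < y"
  shows "\<bar>ln ((F y - F x) / (y - x))\<bar> \<le> K"
proof -
  obtain \<xi> where "F y - F x = (y - x) * exp (\<phi> \<xi>)"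
    using MVT2[OF assms der] by blast
  then show ?thesis using assms phi_bound[of \<xi>] by simp
qed

end

text \<open>A closest return, as provided by \<open>rotation_combinatorics\<close>.\<close>

locale denjoy_return = denjoy_lift +
  fixes q p :: int and N :: nat and \<epsilon> :: real
  assumes eps_eq: "\<epsilon> = of_int q * \<alpha> + of_int p"
    and eps_pos: "0 < \<epsilon>"
    and q_less: "\<bar>q\<bar> < int N"
    and separated: "\<And>i k :: int. i \<noteq> 0 \<Longrightarrow> \<bar>i\<bar> < int N \<Longrightarrow> \<epsilon> \<le> \<bar>of_int i * \<alpha> + of_int k\<bar>"
    and dense: "\<And>z. \<exists>i < 2 * N. \<exists>k :: int. 0 \<le> z - (real i * \<alpha> + of_int k) \<and> z - (real i * \<alpha> + of_int k) < \<epsilon>"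
begin

text \<open>The lift of \<open>F\<^sup>q\<close> that is closest to the identity; \<open>q\<close> may be negative, so that \<open>g\<close> always moves
  points to the right.\<close>

definition g :: "real \<Rightarrow> real" where
  "g x = iter q x + of_int p"

lemma g_continuous: "continuous_on UNIV g"
  unfolding g_def by (intro continuous_intros iter_continuous)

lemma g_shift: "g (x + of_int k) = g x + of_int k"
  by (simp add: g_def iter_shift)

lemma iter_g: "iter i (g x) = g (iter i x)"
proof -
  have "iter (i + q) x = iter (q + i) x" by (simp add: add.commute)
  then show ?thesis by (simp add: g_def iter_shift iter_add)
qed

lemma F_g: "F (g x) = g (F x)"
  using iter_g[of 1 x] iter_of_nat[of 1] by simp

lemma semiconj_g: "semiconj (g x) = semiconj x + \<epsilon>"
  by (simp add: g_def semiconj_shift semiconj_iter eps_eq)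

lemma less_g: "x < g x"
  by (rule less_of_semiconj_less) (simp add: semiconj_g eps_pos)

definition cross :: "real \<Rightarrow> real" where
  "cross w = log_cross_ratio w (g w) (g (g w)) (g (g (g w)))"

definition distortion :: "real \<Rightarrow> real" where
  "distortion w = cross (F w) - cross w"

lemma distortion_shift: "distortion (w + of_int k) = distortion w"
  by (simp add: distortion_def cross_def log_cross_ratio_def g_shift degree_one_add_of_int[of F, OF shift])

lemma distortion_eq:
  "distortion w = log_cross_ratio (F w) (F (g w)) (F (g (g w))) (F (g (g (g w)))) -
     log_cross_ratio w (g w) (g (g w)) (g (g (g w)))"
  by (simp add: distortion_def cross_def F_g)

lemma distortion_le_second_differences:
  obtains u v where "w \<le> u" "u < v" "v \<le> g (g (g w))"
    and "\<bar>distortion w\<bar> \<le> 4 * \<bar>\<phi> u + \<phi> v - 2 * \<phi> ((u + v) / 2)\<bar> + (\<phi> (g (g (g w))) - \<phi> w)\<^sup>2"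
  unfolding distortion_eq
  using log_cross_ratio_distortion_bound[OF less_g[of w] less_g[of "g w"] less_g[of "g (g w)"] strict_mono der phi_continuous]
  by blast

lemma distortion_le: "\<bar>distortion w\<bar> \<le> 4 * K"
proof -
  have "w < g w" "g w < g (g w)" "g (g w) < g (g (g w))" by (rule less_g)+
  moreover from this have "w < g (g (g w))" by linarith
  ultimately show ?thesis
    unfolding distortion_eq
    using ln_slope_bound[of w "g w"] ln_slope_bound[of "g w" "g (g w)"]
      ln_slope_bound[of "g (g w)" "g (g (g w))"] ln_slope_bound[of w "g (g (g w))"]
    by (subst log_cross_ratio_distortion[OF _ _ _ strict_mono]) linarith+
qed

text \<open>Intervals inside \<open>[0, 1]\<close> are paid for by the two variations. At most one interval
  sticks out to the right, and there the trivial bound is good enough.\<close>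

lemma distortion_sum_disjoint:
  assumes "finite S" and w: "\<And>i. i \<in> S \<Longrightarrow> 0 \<le> w i \<and> w i < 1"
    and disj: "\<And>i j. i \<in> S \<Longrightarrow> j \<in> S \<Longrightarrow> i \<noteq> j \<Longrightarrow> g (g (g (w i))) \<le> w j \<or> g (g (g (w j))) \<le> w i"
  shows "(\<Sum>i\<in>S. \<bar>distortion (w i)\<bar>) \<le> 4 * Bz + Bq + 4 * K"
proof -
  define S1 where "S1 = {i \<in> S. g (g (g (w i))) \<le> 1}"
  have S1: "finite S1" "S1 \<subseteq> S" using assms(1) by (auto simp: S1_def)
  have g3: "w i < g (g (g (w i)))" for i
    using less_g[of "w i"] less_g[of "g (w i)"] less_g[of "g (g (w i))"] by linarith
  have "\<forall>i. \<exists>u v. w i \<le> u \<and> u < v \<and> v \<le> g (g (g (w i))) \<and> \<bar>distortion (w i)\<bar>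
      \<le> 4 * \<bar>\<phi> u + \<phi> v - 2 * \<phi> ((u + v) / 2)\<bar> + (\<phi> (g (g (g (w i)))) - \<phi> (w i))\<^sup>2"
    using distortion_le_second_differences by metis
  then obtain u v where uv: "\<And>i. w i \<le> u i \<and> u i < v i \<and> v i \<le> g (g (g (w i)))"
    and le: "\<And>i. \<bar>distortion (w i)\<bar>
      \<le> 4 * \<bar>\<phi> (u i) + \<phi> (v i) - 2 * \<phi> ((u i + v i) / 2)\<bar> + (\<phi> (g (g (g (w i)))) - \<phi> (w i))\<^sup>2"
    by metis
  have zsum: "(\<Sum>i\<in>S1. \<bar>\<phi> (u i) + \<phi> (v i) - 2 * \<phi> ((u i + v i) / 2)\<bar>) \<le> Bz"
  proof (rule disjoint_intervals_sum_le[where a = 0 and b = 1 and g = "\<lambda>x y. \<bar>\<phi> x + \<phi> y - 2 * \<phi> ((x + y) / 2)\<bar>"])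
    show "0 \<le> u i \<and> u i < v i \<and> v i \<le> 1" if "i \<in> S1" for i
      using that uv[of i] w[of i] by (auto simp: S1_def)
    show "v i \<le> u j \<or> v j \<le> u i" if "i \<in> S1" "j \<in> S1" "i \<noteq> j" for i j
      using that uv[of i] uv[of j] disj[of i j] by (force simp: S1_def)
  qed (use zygmund S1 in auto)
  have qsum: "(\<Sum>i\<in>S1. (\<phi> (g (g (g (w i)))) - \<phi> (w i))\<^sup>2) \<le> Bq"
  proof (rule disjoint_intervals_sum_le[where a = 0 and b = 1 and g = "\<lambda>x y. (\<phi> y - \<phi> x)\<^sup>2"])
    show "0 \<le> w i \<and> w i < g (g (g (w i))) \<and> g (g (g (w i))) \<le> 1" if "i \<in> S1" for i
      using that w[of i] g3[of i] by (auto simp: S1_def)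
    show "g (g (g (w i))) \<le> w j \<or> g (g (g (w j))) \<le> w i" if "i \<in> S1" "j \<in> S1" "i \<noteq> j" for i j
      using that disj[of i j] by (auto simp: S1_def)
  qed (use quadratic S1 in auto)
  have "(\<Sum>i\<in>S1. \<bar>distortion (w i)\<bar>)
      \<le> (\<Sum>i\<in>S1. 4 * \<bar>\<phi> (u i) + \<phi> (v i) - 2 * \<phi> ((u i + v i) / 2)\<bar> + (\<phi> (g (g (g (w i)))) - \<phi> (w i))\<^sup>2)"
    by (rule sum_mono) (rule le)
  also have "\<dots> \<le> 4 * Bz + Bq"
    using zsum qsum by (simp add: sum.distrib flip: sum_distrib_left)
  finally have sum1: "(\<Sum>i\<in>S1. \<bar>distortion (w i)\<bar>) \<le> 4 * Bz + Bq" .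
  \<comment> \<open>Disjoint intervals starting in \<open>[0, 1)\<close> cannot both contain \<open>1\<close> in their interior.\<close>
  have "i = j" if "i \<in> S - S1" "j \<in> S - S1" for i j
    using that disj[of i j] w[of i] w[of j] by (force simp: S1_def)
  then have "card (S - S1) \<le> 1"
    using assms(1) by (metis One_nat_def card_le_Suc0_iff_eq finite_Diff)
  then have "real (card (S - S1)) * (4 * K) \<le> 1 * (4 * K)"
    using K_nonneg by (intro mult_right_mono) auto
  moreover have "(\<Sum>i\<in>S - S1. \<bar>distortion (w i)\<bar>) \<le> real (card (S - S1)) * (4 * K)"
    by (rule sum_bounded_above) (rule distortion_le)
  ultimately have "(\<Sum>i\<in>S - S1. \<bar>distortion (w i)\<bar>) \<le> 4 * K" by linarith
  moreover have "(\<Sum>i\<in>S. \<bar>distortion (w i)\<bar>)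
      = (\<Sum>i\<in>S - S1. \<bar>distortion (w i)\<bar>) + (\<Sum>i\<in>S1. \<bar>distortion (w i)\<bar>)"
    by (rule sum.subset_diff[OF S1(2) assms(1)])
  ultimately show ?thesis using sum1 by linarith
qed

lemma residue_gap:
  fixes a b :: int
  assumes "a mod 5 = b mod 5" "a \<noteq> b"
  shows "b + 5 \<le> a \<or> a + 5 \<le> b"
  using assms by presburger

text \<open>Overlaps are controlled in the coordinate given by the semiconjugacy, where the intervals have length
  \<open>3 * \<epsilon>\<close>. Among \<open>N\<close> consecutive iterates the left end points are \<open>\<epsilon>\<close>-separated, so each cell of
  length \<open>\<epsilon>\<close> contains at most one of them. Iterates in the same block of length \<open>N\<close> whose cell numbers
  agree modulo 5 lie at least 5 cells apart, hence their intervals are disjoint. There are 4 blocks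
  and 5 residues, which gives the factor 20.\<close>

lemma distortion_sum_orbit:
  assumes "n \<le> 4 * N"
  shows "(\<Sum>j<n. \<bar>distortion ((F ^^ j) w)\<bar>) \<le> 20 * (4 * Bz + Bq + 4 * K)"
proof -
  define u where "u j = frac ((F ^^ j) w)" for j
  have u_eq: "u j = (F ^^ j) w + of_int (- \<lfloor>(F ^^ j) w\<rfloor>)" for j
    by (simp add: u_def frac_def)
  have semi_u: "semiconj (u j) = semiconj w + real j * \<alpha> + of_int (- \<lfloor>(F ^^ j) w\<rfloor>)" for j
    unfolding u_eq semiconj_shift iter_of_nat[symmetric] semiconj_iter by simp
  have dist_u: "distortion ((F ^^ j) w) = distortion (u j)" for j
    unfolding u_eq by (rule distortion_shift[symmetric])
  define t where "t j = \<lfloor>semiconj (u j) / \<epsilon>\<rfloor>" for j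
  have t: "of_int (t j) * \<epsilon> \<le> semiconj (u j)" "semiconj (u j) < of_int (t j) * \<epsilon> + \<epsilon>" for j
    using floor_divide_lower[OF eps_pos, of "semiconj (u j)"]
      floor_divide_upper[OF eps_pos, of "semiconj (u j)"] by (simp_all add: t_def algebra_simps)
  define key where "key j = (j div N, t j mod 5)" for j
  have N: "N > 0" using q_less by auto
  have far: "g (g (g (u j))) \<le> u i" if "t j + 5 \<le> t i" for i j
  proof -
    have "of_int (t j + 5) * \<epsilon> \<le> of_int (t i) * \<epsilon>"
      using that eps_pos by (intro mult_right_mono) linarith+
    then have "semiconj (u j) + 3 * \<epsilon> < semiconj (u i)"
      using t(2)[of j] t(1)[of i] eps_pos by (simp add: algebra_simps)
    then have "semiconj (g (g (g (u j)))) < semiconj (u i)" by (simp add: semiconj_g)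
    then show ?thesis by (rule less_imp_le[OF less_of_semiconj_less])
  qed
  have disj: "g (g (g (u i))) \<le> u j \<or> g (g (g (u j))) \<le> u i" if "key i = key j" "i \<noteq> j" for i j
  proof -
    have "i div N = j div N" and mod: "t i mod 5 = t j mod 5"
      using that(1) by (auto simp: key_def)
    then have "i = j div N * N + i mod N" "j = j div N * N + j mod N"
      by (metis div_mult_mod_eq)+
    then have "\<bar>int i - int j\<bar> < int N"
      using mod_less_divisor[OF N, of i] mod_less_divisor[OF N, of j] by linarith
    then have "\<epsilon> \<le> \<bar>of_int (int i - int j) * \<alpha> + of_int (\<lfloor>(F ^^ j) w\<rfloor> - \<lfloor>(F ^^ i) w\<rfloor>)\<bar>"
      using that(2) by (intro separated) auto
    also have "of_int (int i - int j) * \<alpha> + of_int (\<lfloor>(F ^^ j) w\<rfloor> - \<lfloor>(F ^^ i) w\<rfloor>) = semiconj (u i) - semiconj (u j)"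
      by (simp add: semi_u algebra_simps)
    finally have "t i \<noteq> t j" using t[of i] t[of j] by auto
    with mod have "t j + 5 \<le> t i \<or> t i + 5 \<le> t j"
      by (rule residue_gap)
    then show ?thesis using far by blast
  qed
  have colour: "(\<Sum>j | j \<in> {..<n} \<and> key j = c. \<bar>distortion (u j)\<bar>) \<le> 4 * Bz + Bq + 4 * K" for c
  proof (rule distortion_sum_disjoint)
    show "0 \<le> u i \<and> u i < 1" for i by (simp add: u_def frac_lt_1)
  qed (use disj in auto)
  have "key ` {..<n} \<subseteq> {..<4} \<times> {0..<5}"
    using assms N by (auto simp: key_def div_less_iff_less_mult)
  then have "(\<Sum>j<n. \<bar>distortion (u j)\<bar>)
      = (\<Sum>c\<in>{..<4} \<times> {0..<5}. \<Sum>j | j \<in> {..<n} \<and> key j = c. \<bar>distortion (u j)\<bar>)"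
    by (intro sum.group[symmetric]) auto
  also have "\<dots> \<le> real (card ({..<4::nat} \<times> {0..<5::int})) * (4 * Bz + Bq + 4 * K)"
    by (rule sum_bounded_above) (rule colour)
  finally show ?thesis by (simp add: dist_u)
qed

lemma cross_pullback:
  assumes "n \<le> 4 * N"
  shows "cross ((F ^^ n) w) - 20 * (4 * Bz + Bq + 4 * K) \<le> cross w"
proof -
  have "cross ((F ^^ n) w) - cross w = (\<Sum>j<n. distortion ((F ^^ j) w))"
    using sum_lessThan_telescope[of "\<lambda>j. cross ((F ^^ j) w)" n] by (simp add: distortion_def)
  also have "\<dots> \<le> (\<Sum>j<n. \<bar>distortion ((F ^^ j) w)\<bar>)"
    by (intro sum_mono) simp
  also have "\<dots> \<le> 20 * (4 * Bz + Bq + 4 * K)"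
    using assms by (rule distortion_sum_orbit)
  finally show ?thesis by simp
qed

text \<open>The displacement of \<open>g\<close> is continuous and periodic.\<close>

lemma shortest_return:
  "\<exists>x0. \<forall>x. g x0 - x0 \<le> g x - x"
proof -
  obtain x0 where "x0 \<in> {0..1}" and min: "\<And>x. x \<in> {0..1} \<Longrightarrow> g x0 - x0 \<le> g x - x"
    using continuous_attains_inf[of "{0..1::real}" "\<lambda>x. g x - x"]
      continuous_on_subset[OF g_continuous] by (force intro: continuous_intros)
  show ?thesis
  proof (intro exI allI)
    fix x
    have "g (frac x) - frac x = g x - x"
      using g_shift[of x "- \<lfloor>x\<rfloor>"] by (simp add: frac_def)
    then show "g x0 - x0 \<le> g x - x"
      using min[of "frac x"] by (simp add: frac_lt_1 less_imp_le)
  qed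
qed

definition ratio_bound :: real where
  "ratio_bound = 3 * exp (20 * (4 * Bz + Bq + 4 * K))"

text \<open>At the base point the cross-ratio is at least 1/3 by minimality. The bound on the distortion carries
  a lower bound over to the pulled back points, and a cross-ratio bounded below prevents the
  middle interval from being much longer than its right neighbour.\<close>

lemma pullback_of_shortest_return:
  assumes min: "\<And>x. g x0 - x0 \<le> g x - x" and "n \<le> 4 * N"
    and y: "y = iter (- int n) x0 + of_int k"
  shows "g y - y \<le> ratio_bound * (g (g y) - g y)"
proof -
  define w0 where "w0 = iter (- q) (x0 - of_int p)"
  have gw0: "g w0 = x0" by (simp add: w0_def g_def)
  define w where "w = iter (- int n) w0"
  have Fw: "(F ^^ n) w = w0" by (simp add: w_def flip: iter_of_nat)
  have y_w: "y = g w + of_int k" by (simp add: y w_def gw0 flip: iter_g)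
  have pos: "ln (1 / 3) \<le> cross w0"
  proof -
    define L M R where "L = x0 - w0" and "M = g x0 - x0" and "R = g (g x0) - g x0"
    have M: "0 < M" "M \<le> L" "M \<le> R"
      using less_g[of x0] min[of w0] min[of "g x0"] by (auto simp: gw0 L_def M_def R_def)
    have "M * (L + M + R) \<le> 3 * (L * R)"
    proof -
      have "M * L \<le> R * L" "M * M \<le> L * R" "M * R \<le> L * R"
        using M by (auto intro!: mult_mono)
      then show ?thesis by (simp add: algebra_simps)
    qed
    then have "1 / 3 \<le> L * R / (M * (L + M + R))"
      using M by (simp add: divide_simps)
    then have "ln (1 / 3) \<le> ln (L * R / (M * (L + M + R)))"
      using M by (subst ln_le_cancel_iff) auto
    also have "\<dots> = ln L + ln R - ln M - ln (L + M + R)"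
      using M by (simp add: ln_mult ln_div)
    also have "\<dots> = cross w0"
      by (simp add: cross_def log_cross_ratio_def gw0 L_def M_def R_def algebra_simps)
    finally show ?thesis .
  qed
  define L M R where "L = g w - w" and "M = g (g w) - g w" and "R = g (g (g w)) - g (g w)"
  have LMR: "0 < L" "0 < M" "0 < R" by (simp_all add: L_def M_def R_def less_g)
  have "ln L + ln R - ln M - ln (L + M + R) = cross w"
    by (simp add: cross_def log_cross_ratio_def L_def M_def R_def algebra_simps)
  then have "ln (1 / 3) - 20 * (4 * Bz + Bq + 4 * K) \<le> ln L + ln R - ln M - ln (L + M + R)"
    using pos cross_pullback[OF assms(2), of w] Fw by simp
  also have "\<dots> \<le> ln R - ln M"
    using LMR by simp
  finally have "ln M \<le> ln 3 + 20 * (4 * Bz + Bq + 4 * K) + ln R"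
    by (simp add: ln_div)
  also have "\<dots> = ln (ratio_bound * R)"
    using LMR by (simp add: ratio_bound_def ln_mult)
  finally have "M \<le> ratio_bound * R"
    using LMR by (subst (asm) ln_le_cancel_iff) (auto simp: ratio_bound_def)
  then show ?thesis by (simp add: y_w g_shift M_def R_def)
qed

text \<open>By density, some pullback \<open>g w\<close> of \<open>x0\<close> lies, in the coordinate given by the semiconjugacy, less
  than \<open>\<epsilon>\<close> to the left of \<open>c\<close> or at \<open>c\<close>. Both this interval and its left neighbour are needed, since
  \<open>g w\<close> may itself be a point of the plateau over \<open>c\<close>. The comparison for the left neighbour requires that
  \<open>w\<close> is a pullback of \<open>x0\<close> as well. The number of steps is therefore taken from the interval from
  \<open>N\<close> to \<open>3 * N\<close>, so that changing it by \<open>q\<close> leaves it between 0 and \<open>4 * N\<close>.\<close>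

lemma comparable_fundamental_intervals:
  obtains w where "semiconj (g w) \<le> c" "c < semiconj (g (g w))"
    and "g (g w) - w \<le> (ratio_bound + ratio_bound\<^sup>2) * (g (g (g w)) - g (g w))"
proof -
  obtain x0 where min: "\<And>x. g x0 - x0 \<le> g x - x"
    using shortest_return by blast
  obtain i k where i: "i < 2 * N"
    and ik: "0 \<le> c - semiconj x0 + real (3 * N - 1) * \<alpha> - (real i * \<alpha> + of_int k)"
      "c - semiconj x0 + real (3 * N - 1) * \<alpha> - (real i * \<alpha> + of_int k) < \<epsilon>"
    using dense[of "c - semiconj x0 + real (3 * N - 1) * \<alpha>"] by blast
  define n where "n = 3 * N - 1 - i"
  have N: "N > 0" using q_less by auto
  have n: "N \<le> n" "n < 3 * N" and real_n: "real n = real (3 * N - 1) - real i"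
    using i N by (auto simp: n_def)
  define m where "m = nat (int n + q)"
  have m: "int m = int n + q" "m \<le> 4 * N" and n4: "n \<le> 4 * N"
    using n q_less by (auto simp: m_def)
  define w where "w = iter (- int m) x0 + of_int (k - p)"
  have gw: "g w = iter (- int n) x0 + of_int k"
  proof -
    have "g w = iter q (iter (- int m) x0) + of_int k"
      by (simp add: w_def g_def iter_shift del: of_int_diff)
    also have "\<dots> = iter (q + (- int m)) x0 + of_int k" by (simp only: iter_add)
    finally show ?thesis by (simp add: m)
  qed
  have semi: "semiconj (g w) = semiconj x0 - real n * \<alpha> + of_int k"
    unfolding gw semiconj_shift semiconj_iter by simp
  define C where "C = ratio_bound"
  have C: "0 < C" by (simp add: C_def ratio_bound_def)
  define R where "R = g (g (g w)) - g (g w)"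
  have "g w - w \<le> C * (g (g w) - g w)"
    unfolding C_def by (rule pullback_of_shortest_return[OF min m(2) w_def])
  moreover have M: "g (g w) - g w \<le> C * R"
    unfolding C_def R_def by (rule pullback_of_shortest_return[OF min n4 gw])
  moreover have "C * (g (g w) - g w) \<le> C * (C * R)"
    using C M by (intro mult_left_mono) auto
  ultimately have "g (g w) - w \<le> (C + C\<^sup>2) * R"
    by (simp add: power2_eq_square algebra_simps)
  moreover have "semiconj (g w) \<le> c" "c < semiconj (g w) + \<epsilon>"
    using ik by (auto simp: semi real_n algebra_simps)
  ultimately show ?thesis
    using that[of w] by (simp add: semiconj_g[of "g w"] C_def R_def)
qed

end

section \<open>Injectivity of the semiconjugacy\<close>

context denjoy_lift
begin

text \<open>A plateau of length \<open>b - a\<close> over the value \<open>c\<close> is covered by the two intervals between \<open>w\<close> and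
  \<open>g (g w)\<close>. The next interval starts to the right of the plateau and ends less than \<open>\<eta>\<close> after
  it, once \<open>\<epsilon>\<close> is small. The comparison of lengths is uniform in \<open>\<epsilon>\<close>, so it fails for \<open>\<eta>\<close> small.\<close>

lemma semiconj_inj: "inj semiconj"
proof (rule ccontr)
  assume "\<not> inj semiconj"
  then obtain a b where ab: "a < b" "semiconj a = semiconj b"
    unfolding inj_def by (metis linorder_neqE)
  define c where "c = semiconj b"
  define C where "C = 3 * exp (20 * (4 * Bz + Bq + 4 * K))"
  have C: "0 < C + C\<^sup>2" by (simp add: C_def add_pos_pos)
  define \<eta> where "\<eta> = (b - a) / (C + C\<^sup>2)"
  have \<eta>: "0 < \<eta>" using ab C by (simp add: \<eta>_def)
  \<comment> \<open>A point of the plateau within distance \<open>\<eta>\<close> of its right end: if there were none, the plateau would be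
     unbounded, by repeatedly moving \<open>b\<close> to the right by \<open>\<eta>\<close>.\<close>
  have "\<exists>x. semiconj x = c \<and> semiconj (x + \<eta>) \<noteq> c"
  proof (rule ccontr)
    assume *: "\<not> ?thesis"
    have all: "semiconj (b + real n * \<eta>) = c" for n
    proof (induction n)
      case (Suc n)
      then show ?case using * by (auto simp: algebra_simps)
    qed (simp add: c_def)
    obtain n where "1 < real n * \<eta>" using reals_Archimedean3[OF \<eta>] by blast
    then have "semiconj (b + 1) \<le> semiconj (b + real n * \<eta>)"
      by (intro monoD[OF semiconj_mono]) simp
    then show False using all[of n] semiconj_shift[of b 1] by (simp add: c_def)
  qed
  then obtain x where x: "semiconj x = c" "semiconj (x + \<eta>) \<noteq> c" by blast
  have "c \<le> semiconj (x + \<eta>)" using monoD[OF semiconj_mono, of x "x + \<eta>"] x(1) \<eta> by simp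
  then have "0 < (semiconj (x + \<eta>) - c) / 2" using x(2) by simp
  from irrational this show False
  proof (rule rotation_combinatorics)
    fix q p :: int and N :: nat and \<epsilon> :: real
    assume small: "\<epsilon> < (semiconj (x + \<eta>) - c) / 2" and
      ret: "\<epsilon> = of_int q * \<alpha> + of_int p" "0 < \<epsilon>" "\<bar>q\<bar> < int N"
      "\<And>i k :: int. i \<noteq> 0 \<Longrightarrow> \<bar>i\<bar> < int N \<Longrightarrow> \<epsilon> \<le> \<bar>of_int i * \<alpha> + of_int k\<bar>"
      "\<And>z. \<exists>i < 2 * N. \<exists>k :: int. 0 \<le> z - (real i * \<alpha> + of_int k) \<and> z - (real i * \<alpha> + of_int k) < \<epsilon>"
    interpret denjoy_return F \<alpha> \<phi> K Bz Bq q p N \<epsilon>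
      by unfold_locales (fact ret)+
    obtain w where w: "semiconj (g w) \<le> c" "c < semiconj (g (g w))"
      and le: "g (g w) - w \<le> (C + C\<^sup>2) * (g (g (g w)) - g (g w))"
      using comparable_fundamental_intervals[of c] unfolding ratio_bound_def C_def by blast
    have "w < a"
      by (rule less_of_semiconj_less) (use w ret(2) ab in \<open>simp add: semiconj_g c_def\<close>)
    moreover have "b < g (g w)"
      by (rule less_of_semiconj_less) (use w in \<open>simp add: c_def\<close>)
    moreover have "x < g (g w)"
      by (rule less_of_semiconj_less) (use w x(1) in simp)
    moreover have "g (g (g w)) < x + \<eta>"
      by (rule less_of_semiconj_less) (use w(1) small in \<open>simp add: semiconj_g\<close>)
    ultimately have "b - a < g (g w) - w" "g (g (g w)) - g (g w) < \<eta>" by linarith+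
    moreover have "(C + C\<^sup>2) * (g (g (g w)) - g (g w)) < (C + C\<^sup>2) * \<eta>"
      using calculation(2) C by (rule mult_strict_left_mono)
    moreover have "(C + C\<^sup>2) * \<eta> = b - a" using C by (simp add: \<eta>_def)
    ultimately show False using le by linarith
  qed
qed

end

section \<open>Circle maps induced by lifts\<close>

definition induced :: "(real \<Rightarrow> real) \<Rightarrow> circle \<Rightarrow> circle" where
  "induced G z = to_circle (G (rep_circle z))"

lemma induced_to_circle:
  assumes shift: "\<And>x k. G (x + of_int k) = G x + of_int k"
  shows "induced G (to_circle x) = to_circle (G x)"
proof -
  have "to_circle (rep_circle (to_circle x)) = to_circle x"
    by (rule Quotient3_abs_rep[OF Quotient3_circle])
  then obtain k where "rep_circle (to_circle x) - x = of_int k"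
    by (auto simp: to_circle_eq_iff elim: Ints_cases)
  then have "rep_circle (to_circle x) = x + of_int k" by simp
  then show ?thesis by (simp add: induced_def shift to_circle_eq_iff)
qed

lemma induced_continuous:
  assumes "continuous_on UNIV G" and shift: "\<And>x k. G (x + of_int k) = G x + of_int k"
  shows "continuous_on UNIV (induced G)"
  unfolding continuous_on_open_vimage[OF open_UNIV]
proof (intro allI impI)
  fix U :: "circle set" assume "open U"
  then have "open (G -` (to_circle -` U))"
    by (intro open_vimage[OF _ assms(1)]) (simp add: open_circle_def)
  moreover have "to_circle -` (induced G -` U) = G -` (to_circle -` U)"
    using induced_to_circle[of G, OF shift] by auto
  ultimately show "open (induced G -` U \<inter> UNIV)"
    by (simp add: open_circle_def)
qed

lemma induced_homeomorphism:
  assumes cont: "continuous_on UNIV G" "continuous_on UNIV G'"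
    and shift: "\<And>x k. G (x + of_int k) = G x + of_int k" "\<And>x k. G' (x + of_int k) = G' x + of_int k"
    and inv: "\<And>x. G' (G x) = x" "\<And>x. G (G' x) = x"
  shows "homeomorphism UNIV UNIV (induced G) (induced G')"
proof -
  note eqs = induced_to_circle[of G, OF shift(1)] induced_to_circle[of G', OF shift(2)] inv
  have "induced G' (induced G z) = z" "induced G (induced G' z) = z" for z
    using to_circle_surj[of z] by (auto simp: eqs)
  then show ?thesis
    using induced_continuous[OF cont(1) shift(1)] induced_continuous[OF cont(2) shift(2)]
    by (intro homeomorphismI) auto
qed

lemma continuous_derivative_of_lift:
  assumes "C1_circle_map f" "is_lift f F"
  shows "\<And>x. (F has_real_derivative deriv F x) (at x)" "continuous_on UNIV (deriv F)"
proof -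
  obtain F0 where F0: "is_lift f F0" "F0 C1_differentiable_on UNIV"
    using assms(1) by (auto simp: C1_circle_map_def)
  then obtain D where D: "\<And>x. (F0 has_real_derivative D x) (at x)" "continuous_on UNIV D"
    by (auto simp: C1_differentiable_on_def has_real_derivative_iff_has_vector_derivative)
  obtain k where k: "\<And>x. F x = F0 x + k"
    using lifts_differ_by_Ints[OF assms(2) F0(1)] by blast
  have "(F has_real_derivative D x) (at x)" for x
    using DERIV_add[OF D(1)[of x] DERIV_const[of k]] by (simp add: k[abs_def])
  then have "deriv F x = D x" "(F has_real_derivative D x) (at x)" for x
    using DERIV_imp_deriv by blast+
  then show "\<And>x. (F has_real_derivative deriv F x) (at x)" "continuous_on UNIV (deriv F)"
    using D(2) by (simp_all add: ext[of "deriv F" D])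
qed

lemma deriv_of_lift_periodic:
  assumes der: "\<And>x. (F has_real_derivative deriv F x) (at x)"
    and shift: "\<And>x k. F (x + of_int k) = F x + of_int k"
  shows "deriv F (x + of_int k) = deriv F x"
proof -
  have "((\<lambda>y. F (y + of_int k)) has_real_derivative deriv F (x + of_int k)) (at x)"
    using der[of "x + of_int k"] by (simp add: DERIV_shift)
  moreover have "((\<lambda>y. F (y + of_int k)) has_real_derivative deriv F x) (at x)"
    using DERIV_add[OF der[of x] DERIV_const[of "of_int k"]] by (simp add: shift)
  ultimately show ?thesis by (rule DERIV_unique)
qed

section \<open>Conjugacy to a rotation\<close>

theorem theoremC:
  fixes f :: "circle \<Rightarrow> circle" and F :: "real \<Rightarrow> real"
  assumes "orientation_preserving_homeo f"
    and "rotation_number f \<notin> \<rat>"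
    and "C1_circle_map f"
    and "is_lift f F"
    and "\<forall>x. deriv F x > 0"
    and "bounded_zygmund_variation 0 1 (\<lambda>x. ln (deriv F x))"
    and "bounded_quadratic_variation 0 1 (\<lambda>x. ln (deriv F x))"
  shows "\<exists>h h' \<alpha>. homeomorphism UNIV UNIV h h' \<and> \<alpha> \<notin> \<rat> \<and> h \<circ> f = rotation \<alpha> \<circ> h"
proof -
  note lift = orientation_preserving_lift[OF assms(1,4)]
  have shift: "F (x + of_int k) = F x + of_int k" for x k
    by (rule degree_one_add_of_int) (rule lift(2))
  have cont: "continuous_on UNIV F" and F: "to_circle (F x) = f (to_circle x)" for x
    using assms(4) by (auto simp: is_lift_def)
  obtain \<alpha> where \<alpha>: "\<And>x. (\<lambda>n. ((F ^^ n) x - x) / real n) \<longlonglongrightarrow> \<alpha>"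
    using translation_limit_exists[of F, OF strict_mono_mono[OF lift(1)] lift(2)] by blast
  have "rotation_number f = frac \<alpha>"
    by (rule rotation_number_eqI[OF assms(1,4) \<alpha>])
  then have irr: "\<alpha> \<notin> \<rat>"
    using assms(2) by (auto simp: frac_def)
  define \<phi> where "\<phi> x = ln (deriv F x)" for x
  have exp_phi: "exp (\<phi> x) = deriv F x" for x
    using assms(5) by (simp add: \<phi>_def)
  note der = continuous_derivative_of_lift[OF assms(3,4)]
  have phi_cont: "continuous_on UNIV \<phi>"
    unfolding \<phi>_def using der(2) assms(5) by (intro continuous_on_ln) (auto simp: less_imp_neq[THEN not_sym])
  have "bounded (\<phi> ` {0..1})"
    by (intro compact_imp_bounded compact_continuous_image continuous_on_subset[OF phi_cont]) auto
  then obtain K where K: "\<forall>x\<in>{0..1}. \<bar>\<phi> x\<bar> \<le> K"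
    by (auto simp: bounded_iff)
  have phi_bound: "\<bar>\<phi> x\<bar> \<le> K" for x
  proof -
    have "deriv F (frac x) = deriv F x"
      using deriv_of_lift_periodic[of F x "- \<lfloor>x\<rfloor>", OF der(1) shift] by (simp add: frac_def)
    then have "\<phi> (frac x) = \<phi> x" by (simp add: \<phi>_def)
    moreover have "frac x \<in> {0..1}" using frac_lt_1[of x] by simp
    ultimately show ?thesis using K by metis
  qed
  obtain Bz where Bz: "\<And>n z. interval_partition 0 1 n z \<Longrightarrow>
      (\<Sum>i<n. \<bar>\<phi> (z i) + \<phi> (z (Suc i)) - 2 * \<phi> ((z i + z (Suc i)) / 2)\<bar>) \<le> Bz"
    using assms(6) unfolding bounded_zygmund_variation_def \<phi>_def by blast
  obtain Bq where Bq: "\<And>n z. interval_partition 0 1 n z \<Longrightarrow>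
      (\<Sum>i<n. (\<phi> (z (Suc i)) - \<phi> (z i))\<^sup>2) \<le> Bq"
    using assms(7) unfolding bounded_quadratic_variation_def \<phi>_def by blast
  interpret denjoy_lift F \<alpha> \<phi> K Bz Bq
  proof unfold_locales
    show "(F has_real_derivative exp (\<phi> x)) (at x)" for x
      unfolding exp_phi by (rule der(1))
  qed (fact cont lift irr \<alpha> phi_cont phi_bound Bz Bq)+
  have "semiconj (x + 1) = semiconj x + 1" for x
    using semiconj_shift[of x 1] by simp
  with semiconj_continuous have surj: "surj semiconj"
    by (rule degree_one_surj)
  have inv: "inv semiconj (semiconj x) = x" "semiconj (inv semiconj x) = x" for x
    using semiconj_inj surj by (simp_all add: surj_f_inv_f)
  have "range (inv semiconj) = UNIV"
    using semiconj_inj by (rule inj_imp_surj_inv)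
  moreover have "inv semiconj x \<le> inv semiconj y" if "x \<le> y" for x y
    using that less_of_semiconj_less[of "inv semiconj x" "inv semiconj y"]
    by (cases "x = y") (auto simp: inv)
  ultimately have "continuous_on UNIV (inv semiconj)"
    by (intro continuous_onI_mono) auto
  moreover have "inv semiconj (x + of_int k) = inv semiconj x + of_int k" for x k
  proof -
    have "semiconj (inv semiconj x + of_int k) = x + of_int k"
      by (simp only: semiconj_shift inv)
    then show ?thesis using inv(1)[of "inv semiconj x + of_int k"] by simp
  qed
  ultimately have "homeomorphism UNIV UNIV (induced semiconj) (induced (inv semiconj))"
    using semiconj_continuous semiconj_shift inv by (intro induced_homeomorphism)
  moreover have "induced semiconj \<circ> f = rotation \<alpha> \<circ> induced semiconj"
  proof
    fix z
    obtain x where z: "z = to_circle x" using to_circle_surj by blast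
    have "semiconj (F x) = semiconj x + \<alpha>"
      using semiconj_iter[of 1 x] iter_of_nat[of 1] by simp
    then show "(induced semiconj \<circ> f) z = (rotation \<alpha> \<circ> induced semiconj) z"
      by (simp add: z F[symmetric] induced_to_circle[of semiconj, OF semiconj_shift] rotation.abs_eq)
  qed
  ultimately show ?thesis using irr by blast
qed

end
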